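(* There is no Leech tree on $18$ vertices.
   Context: Let $T=(V,E,w)$ be a finite simple tree with a strictly positive integral edge-weight function $w:E\to\{1,2,3,\ldots\}$, and let $n=|V|$ (the order of $T$). The weighted distance $d_T(x,y)$ between two vertices is the sum of the edge weights on the unique simple path connecting them. $T$ is a Leech tree if the $\binom n2$ distances $d_T(x,y)$, indexed by unordered pairs $\{x,y\}$ of distinct vertices, are exactly $1,2,\ldots,\binom n2$, each occurring exactly once. *)

theory Defs
  imports Complex_Main
begin

text \<open>A graph is a vertex set \<open>V\<close> with a set \<open>E\<close> of two-element subsets of \<open>V\<close>.\<close>

definition fin_simple_graph :: "'a set \<Rightarrow> 'a set set \<Rightarrow> bool" where
  "fin_simple_graph V E \<longleftrightarrow> finite V \<and> (\<forall>e\<in>E. e \<subseteq> V \<and> card e = 2)"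

text \<open>The edges traversed by a vertex sequence, in order.\<close>

fun walk_edges :: "'a list \<Rightarrow> 'a set list" where
  "walk_edges (x # y # xs) = {x, y} # walk_edges (y # xs)"
| "walk_edges _ = []"

definition simple_path :: "'a set \<Rightarrow> 'a set set \<Rightarrow> 'a \<Rightarrow> 'a list \<Rightarrow> 'a \<Rightarrow> bool" where
  "simple_path V E x p y \<longleftrightarrow>
     p \<noteq> [] \<and> hd p = x \<and> last p = y \<and> distinct p \<and> set p \<subseteq> V \<and> set (walk_edges p) \<subseteq> E"

definition connected_graph :: "'a set \<Rightarrow> 'a set set \<Rightarrow> bool" where
  "connected_graph V E \<longleftrightarrow> V \<noteq> {} \<and> (\<forall>x\<in>V. \<forall>y\<in>V. \<exists>p. simple_path V E x p y)"

text \<open>A cycle is listed without repeating its first vertex at the end; the bound on its length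
  excludes going back and forth along one edge.\<close>

definition graph_cycle :: "'a set \<Rightarrow> 'a set set \<Rightarrow> 'a list \<Rightarrow> bool" where
  "graph_cycle V E c \<longleftrightarrow>
     length c \<ge> 3 \<and> distinct c \<and> set c \<subseteq> V \<and> set (walk_edges c) \<subseteq> E \<and> {last c, hd c} \<in> E"

definition tree_graph :: "'a set \<Rightarrow> 'a set set \<Rightarrow> bool" where
  "tree_graph V E \<longleftrightarrow>
     fin_simple_graph V E \<and> connected_graph V E \<and> (\<nexists>c. graph_cycle V E c)"

text \<open>Meaningful when \<open>V\<close>, \<open>E\<close> form a tree and \<open>x\<close>, \<open>y\<close> are vertices, since the simple path from
  \<open>x\<close> to \<open>y\<close> then exists and is unique.\<close>

definition tree_dist :: "'a set \<Rightarrow> 'a set set \<Rightarrow> ('a set \<Rightarrow> nat) \<Rightarrow> 'a \<Rightarrow> 'a \<Rightarrow> nat" where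
  "tree_dist V E w x y = sum_list (map w (walk_edges (THE p. simple_path V E x p y)))"

text \<open>In the last conjunct \<open>P\<close> is an unordered pair, so that the two equal distances from \<open>x\<close> to
  \<open>y\<close> and from \<open>y\<close> to \<open>x\<close> count as one occurrence.\<close>

definition leech_tree :: "'a set \<Rightarrow> 'a set set \<Rightarrow> ('a set \<Rightarrow> nat) \<Rightarrow> bool" where
  "leech_tree V E w \<longleftrightarrow>
     tree_graph V E \<and> (\<forall>e\<in>E. w e \<ge> 1) \<and>
     (\<forall>x\<in>V. \<forall>y\<in>V. x \<noteq> y \<longrightarrow> tree_dist V E w x y \<in> {1..card V choose 2}) \<and>
     (\<forall>k\<in>{1..card V choose 2}.
        \<exists>!P. \<exists>x\<in>V. \<exists>y\<in>V. x \<noteq> y \<and> P = {x, y} \<and> tree_dist V E w x y = k)"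

end

theory Submission
  imports Defs "HOL-Library.Sublist"
begin

text \<open>Let \<open>u\<close>, \<open>v\<close> be the vertices at distance 153. The number \<open>d x u + d x v\<close> is always odd, so every vertex is
  strictly closer to one of them; call this its side, and let its height be 153 minus its distance to the
  other endpoint. Heights are at most 76, and they separate the vertices of a side. The deficit
  \<open>153 - d x y\<close> equals \<open>h x + h y\<close> for vertices of different sides, and \<open>153 + h x + h y - 2 * h m\<close> for
  vertices of the same side, where \<open>m\<close> is the median of \<open>x\<close>, \<open>y\<close> and the far endpoint. Each of the deficits
  \<open>0, ..., 152\<close> occurs exactly once. Increasing \<open>k\<close>, suppose that the smaller deficits are accounted for. If the deficit
  \<open>k\<close> is not, it is due either to a new vertex of height \<open>k\<close>, paired with the far endpoint, or to two known vertices
  of one side, whose median is thereby determined. In this way the tree is reconstructed from its two ends towards the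
  middle, and an exhaustive search, carried out by the simplifier, shows that no branch reaches \<open>k = 153\<close>.\<close>

section \<open>Distances in a tree\<close>

text \<open>The constant 153 is \<open>18 choose 2\<close>, and 76 is half of it rounded down. With
  the far endpoint as root, the median of two vertices of a side is their lowest common ancestor,
  and heights grow towards the root; hence the height of the median is an ultrametric
  \<open>z\<close>. This is what keeps the branching small. If the median of a pair is unknown, its
  deficit can still be bounded below by way of a third vertex. Taking the least height
  \<open>r\<close> of a subtree as the third vertex shows that an open height can produce the
  current deficit \<open>k\<close> only together with \<open>r\<close>. So every subtree needs just
  one queue of open heights, compared with \<open>r\<close> alone. Once \<open>k\<close> has passed
  the deficit that an open height would have by meeting \<open>r\<close> at the topmost branching
  vertex, the two must meet strictly below it, and the open height moves down. A median forced by a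
  branch need not be a known vertex; it may be open elsewhere, or it uses up one of the 18 vertices
  before \<open>k\<close> has reached its height. A branch dies when a deficit would have to be
  entered twice or when the vertices run out.\<close>

lemma walk_edges_append: "walk_edges (p @ x # q) = walk_edges (p @ [x]) @ walk_edges (x # q)"
proof (induction p)
  case (Cons a p)
  then show ?case by (cases p) auto
qed simp

lemma walk_edges_snoc: "p \<noteq> [] \<Longrightarrow> walk_edges (p @ [x]) = walk_edges p @ [{last p, x}]"
  by (induction p rule: walk_edges.induct) auto

lemma walk_edges_rev: "walk_edges (rev p) = rev (walk_edges p)"
proof (induction p rule: walk_edges.induct)
  case (1 x y xs)
  have "walk_edges (rev (x # y # xs)) = walk_edges (rev xs @ [y]) @ [{y, x}]"
    using walk_edges_append[of "rev xs" y "[x]"] by simp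
  then show ?case using 1 by (simp add: insert_commute)
qed auto

lemma simple_path_split:
  assumes "simple_path V E x (p @ t # q) y"
  shows "simple_path V E x (p @ [t]) t" "simple_path V E t (t # q) y"
  using assms walk_edges_append[of p t q] unfolding simple_path_def by (auto simp: hd_append)

lemma simple_path_rev: "simple_path V E x p y \<Longrightarrow> simple_path V E y (rev p) x"
  by (auto simp: simple_path_def walk_edges_rev hd_rev last_rev)

lemma simple_path_ends: "simple_path V E x p y \<Longrightarrow> x \<in> V \<and> y \<in> V"
  by (auto simp: simple_path_def)

lemma simple_path_self: "simple_path V E x p x \<Longrightarrow> p = [x]"
  by (cases p) (auto simp: simple_path_def split: if_splits)

text \<open>Induction on the total length: a common inner vertex cuts both paths into shorter pairs.
  Without one, \<open>p\<close> followed by the reversal of \<open>q\<close> closes to a cycle,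
  unless both are the same single edge.\<close>

lemma simple_path_unique:
  assumes tree: "tree_graph V E" and "simple_path V E x p y" "simple_path V E x q y"
  shows "p = q"
  using assms(2,3)
proof (induction "length p + length q" arbitrary: x y p q rule: less_induct)
  case less
  show ?case
  proof (cases "x = y")
    case True
    then show ?thesis using less.prems simple_path_self by metis
  next
    case False
    show ?thesis
    proof (cases "\<exists>t. t \<in> set p \<and> t \<in> set q \<and> t \<noteq> x \<and> t \<noteq> y")
      case True
      then obtain t p1 p2 q1 q2 where t: "p = p1 @ t # p2" "q = q1 @ t # q2" "t \<noteq> x" "t \<noteq> y"
        by (metis split_list)
      have ne: "p1 \<noteq> []" "p2 \<noteq> []" "q1 \<noteq> []" "q2 \<noteq> []"
        using t less.prems by (auto simp: simple_path_def)
      have "p1 @ [t] = q1 @ [t]"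
        by (rule less.hyps[of _ _ x t])
          (use t ne simple_path_split(1) less.prems in \<open>auto simp: Suc_le_eq\<close>)
      moreover have "t # p2 = t # q2"
        by (rule less.hyps[of _ _ t y])
          (use t ne simple_path_split(2) less.prems in \<open>auto simp: Suc_le_eq\<close>)
      ultimately show ?thesis using t by simp
    next
      case F: False
      have form: "\<exists>m. r = x # m @ [y]" if "simple_path V E x r y" for r
      proof -
        from that \<open>x \<noteq> y\<close> obtain r' where r: "r = x # r'" "r' \<noteq> []"
          by (cases r) (auto simp: simple_path_def split: if_splits)
        then have "r' = butlast r' @ [y]" using that append_butlast_last_id[of r'] by (simp add: simple_path_def)
        then show ?thesis using r by auto
      qed
      obtain n m where p: "p = x # n @ [y]" and q: "q = x # m @ [y]" using form less.prems by blast
      show ?thesis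
      proof (rule ccontr)
        assume ne: "p \<noteq> q"
        define c where "c = x # n @ [y] @ rev m"
        have P: "simple_path V E x (x # n @ [y]) y" and Q: "simple_path V E x (x # m @ [y]) y" using less.prems p q by auto
        have "distinct c" using P Q F p q by (auto simp: c_def simple_path_def)
        moreover have "3 \<le> length c" using ne p q by (cases n; cases m) (auto simp: c_def)
        moreover have "set c \<subseteq> V" using P Q by (auto simp: c_def simple_path_def)
        moreover have rq: "set (walk_edges ((y # rev m) @ [x])) \<subseteq> E"
          using simple_path_rev[OF Q] by (simp add: simple_path_def)
        have "set (walk_edges c) \<subseteq> E"
        proof -
          have "walk_edges c = walk_edges (x # n @ [y]) @ walk_edges (y # rev m)"
            using walk_edges_append[of "x # n" y "rev m"] by (simp add: c_def)
          then show ?thesis using P rq walk_edges_snoc[of "y # rev m" x] by (auto simp: simple_path_def)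
        qed
        moreover have "{last c, hd c} \<in> E"
          using rq walk_edges_snoc[of "y # rev m" x] by (auto simp: c_def)
        ultimately have "graph_cycle V E c" by (simp add: graph_cycle_def)
        then show False using tree by (auto simp: tree_graph_def)
      qed
    qed
  qed
qed

section \<open>Path weights, medians and the four-point condition\<close>

definition weight :: "('a set \<Rightarrow> nat) \<Rightarrow> 'a list \<Rightarrow> nat" where
  "weight w p = sum_list (map w (walk_edges p))"

lemma weight_append: "weight w (p @ x # q) = weight w (p @ [x]) + weight w (x # q)"
  by (simp add: weight_def walk_edges_append[of p x q])

lemma weight_rev: "weight w (rev p) = weight w p"
  by (simp add: weight_def walk_edges_rev rev_map[symmetric])

lemma weight_prefix: "prefix p q \<Longrightarrow> weight w p \<le> weight w q"
proof (induction q rule: rev_induct)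
  case (snoc x q)
  then show ?case
    by (cases "q = []") (auto simp: weight_def walk_edges_snoc prefix_Cons)
qed simp

locale weighted_tree =
  fixes V :: "'a set" and E :: "'a set set" and w :: "'a set \<Rightarrow> nat"
  assumes tree: "tree_graph V E"
begin

abbreviation "d \<equiv> tree_dist V E w"

definition path :: "'a \<Rightarrow> 'a \<Rightarrow> 'a list" where
  "path x y = (THE p. simple_path V E x p y)"

lemma path_eq: "simple_path V E x p y \<Longrightarrow> path x y = p"
  unfolding path_def using simple_path_unique[OF tree] by blast

lemma path: "x \<in> V \<Longrightarrow> y \<in> V \<Longrightarrow> simple_path V E x (path x y) y"
  using tree path_eq by (metis connected_graph_def tree_graph_def)

lemma dist_eq: "simple_path V E x p y \<Longrightarrow> d x y = weight w p"
  using path_eq by (simp add: tree_dist_def weight_def path_def)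

lemma dist_self: "x \<in> V \<Longrightarrow> d x x = 0"
  using dist_eq[of x "[x]" x] by (simp add: simple_path_def weight_def)

lemma dist_sym: "x \<in> V \<Longrightarrow> y \<in> V \<Longrightarrow> d x y = d y x"
  using dist_eq[OF path] dist_eq[OF simple_path_rev[OF path]] weight_rev by metis

text \<open>Paths from a common root branch off at the end of their longest common prefix.\<close>

definition fork :: "'a \<Rightarrow> 'a \<Rightarrow> 'a \<Rightarrow> 'a list" where
  "fork v x y = longest_common_prefix (path v x) (path v y)"

text \<open>\<open>m\<close> is the last vertex of the fork. Behind it the two paths share no vertex
  \<open>t\<close>: the path from \<open>v\<close> to \<open>t\<close> is unique, so the common
  prefix would extend to \<open>t\<close>. Hence one remainder reversed, then \<open>m\<close>, then
  the other remainder form the simple path from \<open>x\<close> to \<open>y\<close>.\<close>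

lemma fork_dist:
  assumes V: "v \<in> V" "x \<in> V" "y \<in> V"
  obtains m where "m \<in> V" "d v m = weight w (fork v x y)" "d v x = d v m + d m x" "d v y = d v m + d m y" "d x y = d m x + d m y"
proof -
  let ?c = "fork v x y"
  obtain a b where ab: "path v x = ?c @ a" "path v y = ?c @ b"
    unfolding fork_def
    by (metis longest_common_prefix_prefix1 longest_common_prefix_prefix2 prefix_def)
  have P: "simple_path V E v (?c @ a) x" "simple_path V E v (?c @ b) y" using path V ab by metis+
  have "?c \<noteq> []"
  proof -
    have "prefix [v] (path v x)" "prefix [v] (path v y)"
      using path[OF V(1,2)] path[OF V(1,3)] by (cases "path v x"; cases "path v y"; auto simp: simple_path_def)+
    then have "prefix [v] ?c" unfolding fork_def by (rule longest_common_prefix_max_prefix)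
    then show ?thesis by auto
  qed
  then obtain c m where c: "?c = c @ [m]" by (metis rev_exhaust)
  have Pm: "simple_path V E v (c @ [m]) m" "simple_path V E m (m # a) x" "simple_path V E m (m # b) y"
    using simple_path_split[of V E v c m a x] simple_path_split[of V E v c m b y] P c by auto
  have disj: "set a \<inter> set b = {}"
  proof (rule ccontr)
    assume "\<not> ?thesis"
    then obtain t a1 a2 b1 b2 where t: "a = a1 @ t # a2" "b = b1 @ t # b2" by (meson disjoint_iff split_list)
    have "simple_path V E v ((?c @ a1) @ [t]) t" "simple_path V E v ((?c @ b1) @ [t]) t"
      using P t simple_path_split(1)[of V E v "?c @ a1" t a2 x] simple_path_split(1)[of V E v "?c @ b1" t b2 y] by auto
    then have "a1 = b1" using simple_path_unique[OF tree] by fastforce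
    then have "prefix (?c @ a1 @ [t]) (path v x)" "prefix (?c @ a1 @ [t]) (path v y)" using t ab by auto
    then have "prefix (?c @ a1 @ [t]) ?c" unfolding fork_def by (rule longest_common_prefix_max_prefix)
    then show False by (auto dest: prefix_length_le)
  qed
  have "simple_path V E x (rev a @ m # b) y"
  proof -
    have "set (walk_edges (rev a @ m # b)) = set (walk_edges (rev (m # a))) \<union> set (walk_edges (m # b))"
      using walk_edges_append[of "rev a" m b] by simp
    moreover have "hd (rev a @ m # b) = x" using Pm(2) by (cases a rule: rev_cases) (auto simp: simple_path_def)
    ultimately show ?thesis using Pm disj unfolding simple_path_def walk_edges_rev by auto
  qed
  then have "d x y = weight w (rev (m # a)) + weight w (m # b)"
    using dist_eq weight_append[of w "rev a" m b] by simp
  then have "d x y = d m x + d m y" using dist_eq Pm weight_rev by metis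
  moreover have "d v x = d v m + d m x" "d v y = d v m + d m y"
    using dist_eq[OF P(1)] dist_eq[OF P(2)] dist_eq[OF Pm(1)] dist_eq[OF Pm(2)] dist_eq[OF Pm(3)] c
      weight_append[of w c m a] weight_append[of w c m b] by auto
  moreover have "d v m = weight w ?c" using dist_eq[OF Pm(1)] c by simp
  moreover have "m \<in> V" using Pm simple_path_ends by metis
  ultimately show ?thesis using that by blast
qed

lemma median:
  assumes "v \<in> V" "x \<in> V" "y \<in> V"
  shows "\<exists>m\<in>V. d x v = d x m + d m v \<and> d y v = d y m + d m v \<and> d x y = d x m + d m y"
proof -
  obtain m where "m \<in> V" "d v x = d v m + d m x" "d v y = d v m + d m y" "d x y = d m x + d m y"
    using fork_dist[OF assms] .
  then show ?thesis using dist_sym assms by (metis add.commute)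
qed

text \<open>Fork weights are Gromov products based at \<open>v\<close>. Both forks involving
  \<open>t\<close> are prefixes of the path to \<open>t\<close>, hence comparable, and the shorter
  one is contained in the fork of \<open>x\<close> and \<open>y\<close>. This ultrametric inequality
  for Gromov products is the four-point condition.\<close>

lemma four_point:
  assumes V: "v \<in> V" "x \<in> V" "y \<in> V" "t \<in> V"
  shows "d x y + d v t \<le> max (d x t + d v y) (d t y + d v x)"
proof -
  have "prefix (fork v x t) (fork v t y) \<or> prefix (fork v t y) (fork v x t)"
    unfolding fork_def by (meson longest_common_prefix_prefix1 longest_common_prefix_prefix2 prefix_same_cases)
  then have "prefix (fork v x t) (fork v x y) \<or> prefix (fork v t y) (fork v x y)"
    unfolding fork_def
    by (meson longest_common_prefix_max_prefix longest_common_prefix_prefix1 longest_common_prefix_prefix2 prefix_order.trans)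
  then have le: "weight w (fork v x t) \<le> weight w (fork v x y) \<or> weight w (fork v t y) \<le> weight w (fork v x y)"
    using weight_prefix by blast
  obtain m where m: "d v m = weight w (fork v x y)" "d v x = d v m + d m x" "d v y = d v m + d m y" "d x y = d m x + d m y"
    using fork_dist V by metis
  obtain m' where m': "d v m' = weight w (fork v x t)" "d v x = d v m' + d m' x" "d v t = d v m' + d m' t" "d x t = d m' x + d m' t"
    using fork_dist V by metis
  obtain m'' where m'': "d v m'' = weight w (fork v t y)" "d v t = d v m'' + d m'' t" "d v y = d v m'' + d m'' y" "d t y = d m'' t + d m'' y"
    using fork_dist V by metis
  show ?thesis using le m m' m'' by linarith
qed

end

section \<open>The search\<close>

datatype trie = Tip | Bin bool trie trie

fun mem_num :: "num \<Rightarrow> trie \<Rightarrow> bool" where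
  "mem_num n Tip = False"
| "mem_num num.One (Bin a l r) = a"
| "mem_num (num.Bit0 n) (Bin a l r) = mem_num n l"
| "mem_num (num.Bit1 n) (Bin a l r) = mem_num n r"

fun ins_num :: "num \<Rightarrow> trie \<Rightarrow> trie" where
  "ins_num num.One Tip = Bin True Tip Tip"
| "ins_num num.One (Bin a l r) = Bin True l r"
| "ins_num (num.Bit0 n) Tip = Bin False (ins_num n Tip) Tip"
| "ins_num (num.Bit0 n) (Bin a l r) = Bin a (ins_num n l) r"
| "ins_num (num.Bit1 n) Tip = Bin False Tip (ins_num n Tip)"
| "ins_num (num.Bit1 n) (Bin a l r) = Bin a l (ins_num n r)"

definition has :: "nat \<Rightarrow> trie \<Rightarrow> bool" where "has e u = (e = 0 \<or> mem_num (num_of_nat e) u)"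

definition ins :: "nat \<Rightarrow> trie \<Rightarrow> trie" where "ins e u = ins_num (num_of_nat e) u"

text \<open>\<open>Lf r os\<close> stands for the vertex of height \<open>r\<close>, to which the heights \<open>os\<close> have not yet been related.
  In \<open>Br r b l t os\<close> the subtree \<open>t\<close> branches off \<open>l\<close> at a vertex of height \<open>c\<close> with \<open>b = 153 - 2 * c\<close>,
  so that \<open>x\<close> in \<open>l\<close> and \<open>y\<close> in \<open>t\<close> have deficit \<open>b + x + y\<close>; \<open>r\<close> is the least height in \<open>l\<close>.
  A trie contains the deficits of all pairs whose deficit is determined; being a pair of endpoints, 0 is implicit.\<close>

datatype tree = Lf nat "nat list" | Br nat nat tree tree "nat list"

fun members :: "tree \<Rightarrow> nat list" where
  "members (Lf r os) = r # os"
| "members (Br r b l t os) = members l @ members t @ os"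

fun opens :: "tree \<Rightarrow> nat list" where
  "opens (Lf r os) = os"
| "opens (Br r b l t os) = os"

fun rep :: "tree \<Rightarrow> nat" where
  "rep (Lf r os) = r"
| "rep (Br r b l t os) = r"

section \<open>Entering deficits and moving open heights down\<close>

primrec recs :: "nat list \<Rightarrow> nat \<Rightarrow> trie \<Rightarrow> trie option" where
  "recs [] c u = Some u"
| "recs (m # ms) c u = (if has (c + m) u then None else recs ms c (ins (c + m) u))"

fun put :: "nat \<Rightarrow> tree \<Rightarrow> tree" where
  "put x (Lf r os) = Lf r (os @ [x])"
| "put x (Br r b l t os) = Br r b l t (os @ [x])"

fun with_open :: "nat list \<Rightarrow> tree \<Rightarrow> tree" where
  "with_open os' (Lf r os) = Lf r os'"
| "with_open os' (Br r b l t os) = Br r b l t os'"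

text \<open>\<open>b + r + x\<close> is the deficit of \<open>r\<close> and \<open>x\<close> if they
  meet at the branching vertex. When it equals a \<open>k\<close> that another pair owns, they meet
  lower: \<open>x\<close> joins \<open>l\<close>, and its deficits with \<open>t\<close> become
  known. Open lists increase, so only the head can be due.\<close>

definition adv_top :: "nat \<Rightarrow> nat \<Rightarrow> nat \<Rightarrow> tree \<Rightarrow> tree \<Rightarrow> nat list \<Rightarrow> trie \<Rightarrow> (tree \<times> trie) option" where
  "adv_top k r b l t os u = (case os of [] \<Rightarrow> Some (Br r b l t [], u)
     | x # xs \<Rightarrow> if b + r + x = k then map_option (\<lambda>u. (Br r b (put x l) t xs, u)) (recs (members t) (b + x) u)
       else Some (Br r b l t (x # xs), u))"

primrec adv :: "tree \<Rightarrow> nat \<Rightarrow> trie \<Rightarrow> (tree \<times> trie) option" where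
  "adv (Lf r os) k u = Some (Lf r os, u)"
| "adv (Br r b l t os) k u = (case adv l k u of None \<Rightarrow> None | Some (l, u) \<Rightarrow>
     (case adv t k u of None \<Rightarrow> None | Some (t, u) \<Rightarrow> adv_top k r b l t os u))"

section \<open>Branches for a deficit produced within one side\<close>

fun maps :: "('a \<Rightarrow> 'b list) \<Rightarrow> 'a list \<Rightarrow> 'b list" where "maps f [] = []" | "maps f (x # xs) = f x @ maps f xs"

text \<open>In \<open>Pend z T u\<close> the branching vertex \<open>z\<close> is a new vertex of \<open>T\<close>: its deficits with the vertices outside \<open>T\<close>
  are still to be entered.\<close>

datatype item = Done tree trie | Pend nat tree trie

definition lab :: "nat \<Rightarrow> nat" where "lab z = 153 - 2 * z"

text \<open>\<open>z\<close> is the proposed median of \<open>r\<close> and \<open>x\<close>. If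
  \<open>z = x\<close>, then \<open>x\<close> is an ancestor of \<open>r\<close> and hangs alone;
  otherwise \<open>x\<close> hangs below \<open>z\<close>. An open height of this node equal to
  \<open>z\<close> is that median; failing this, \<open>z\<close> is new to the subtree but may
  still be open at an enclosing node.\<close>

definition attach :: "nat \<Rightarrow> tree \<Rightarrow> nat \<Rightarrow> nat list \<Rightarrow> nat \<Rightarrow> trie \<Rightarrow> item list" where
  "attach r S x os z u = (case recs (members S) (lab z + x) u of None \<Rightarrow> [] | Some u \<Rightarrow>
     if z = x then [Done (Br r (lab z) S (Lf z []) os) u]
     else (case recs (x # members S) (lab z + z) u of None \<Rightarrow> [] | Some u \<Rightarrow>
       (let T = \<lambda>os. Br r (lab z) S (Br x (lab z) (Lf x []) (Lf z []) []) os in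
        if z \<in> set os then [Done (T (remove1 z os)) u] else [Pend z (T os) u])))"

text \<open>The deficit of \<open>r\<close> and \<open>x\<close> is \<open>k\<close> iff twice the
  median height is \<open>(153 - k) + r + x\<close>; with \<open>q = (153 - k) + r\<close> this
  explains the parity test and the halving. The smaller open heights \<open>lo\<close> meet
  \<open>r\<close> below the new median and therefore stay open inside \<open>S\<close>.\<close>

primrec attach_all :: "nat list \<Rightarrow> nat list \<Rightarrow> tree \<Rightarrow> nat \<Rightarrow> nat \<Rightarrow> trie \<Rightarrow> item list" where
  "attach_all [] lo S r q u = []"
| "attach_all (x # os) lo S r q u =
     (if even (q + x) then attach r (with_open lo S) x os ((q + x) div 2) u else []) @ attach_all os (lo @ [x]) S r q u"

text \<open>The case in which \<open>r\<close> and \<open>x\<close> meet at the existing branching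
  vertex. A hanging leaf is this vertex itself, so \<open>x\<close> is placed below it under the
  same label \<open>b\<close>; in a larger \<open>t\<close> the position of \<open>x\<close> is not
  known, and \<open>x\<close> becomes open there.\<close>

definition split_off :: "nat \<Rightarrow> nat \<Rightarrow> tree \<Rightarrow> tree \<Rightarrow> nat \<Rightarrow> nat list \<Rightarrow> trie \<Rightarrow> item list" where
  "split_off r b l t x os u = (case recs (members l) (b + x) u of None \<Rightarrow> [] | Some u \<Rightarrow>
     (case t of Lf z _ \<Rightarrow> (case recs [z] (b + x) u of None \<Rightarrow> [] | Some u \<Rightarrow> [Done (Br r b l (Br x b (Lf x []) t []) os) u])
      | Br _ _ _ _ _ \<Rightarrow> [Done (Br r b l (put x t) os) u]))"

text \<open>An open height with \<open>b + r + x > k\<close> that produces \<open>k\<close> together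
  with \<open>r\<close> meets \<open>r\<close> strictly above the branching vertex, so the new node
  goes on top. Equality is possible for the head only.\<close>

definition top_items :: "nat \<Rightarrow> nat \<Rightarrow> nat \<Rightarrow> nat \<Rightarrow> tree \<Rightarrow> tree \<Rightarrow> nat list \<Rightarrow> trie \<Rightarrow> item list" where
  "top_items k K r b l t os u = (case os of [] \<Rightarrow> [] | x # xs \<Rightarrow>
     if b + r + x = k then split_off r b l t x xs u @ attach_all xs [x] (Br r b l t []) r (K + r) u
     else attach_all (x # xs) [] (Br r b l t []) r (K + r) u)"

text \<open>A pending median meets everything in the sibling subtree at the branching vertex. If its
  height is open at this node, it is that known vertex and is no longer pending.\<close>

fun raise_left :: "nat \<Rightarrow> nat \<Rightarrow> tree \<Rightarrow> nat list \<Rightarrow> item \<Rightarrow> item list" where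
  "raise_left r b t os (Done l u) = [Done (Br r b l t os) u]"
| "raise_left r b t os (Pend z l u) = (case recs (members t) (b + z) u of None \<Rightarrow> [] | Some u \<Rightarrow>
     if z \<in> set os then [Done (Br r b l t (remove1 z os)) u] else [Pend z (Br r b l t os) u])"

fun raise_right :: "nat \<Rightarrow> nat \<Rightarrow> tree \<Rightarrow> nat list \<Rightarrow> item \<Rightarrow> item list" where
  "raise_right r b l os (Done t u) = [Done (Br r b l t os) u]"
| "raise_right r b l os (Pend z t u) = (case recs (members l) (b + z) u of None \<Rightarrow> [] | Some u \<Rightarrow>
     if z \<in> set os then [Done (Br r b l t (remove1 z os)) u] else [Pend z (Br r b l t os) u])"

primrec items :: "tree \<Rightarrow> nat \<Rightarrow> nat \<Rightarrow> trie \<Rightarrow> item list" where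
  "items (Lf r os) k K u = attach_all os [] (Lf r []) r (K + r) u"
| "items (Br r b l t os) k K u = top_items k K r b l t os u
     @ maps (raise_left r b t os) (items l k K u) @ maps (raise_right r b l os) (items t k K u)"

section \<open>States, levels and the search loop\<close>

datatype result = Res tree trie "unit list"

text \<open>A median still pending at the top is a vertex not met before: it uses up one of the
  remaining vertices, and its deficits with the other side are sums of heights.\<close>

fun finish :: "nat list \<Rightarrow> unit list \<Rightarrow> item \<Rightarrow> result list" where
  "finish om n (Done T u) = [Res T u n]"
| "finish om [] (Pend z T u) = []"
| "finish om (_ # n) (Pend z T u) = (case recs om z u of None \<Rightarrow> [] | Some u \<Rightarrow> [Res T u n])"

fun new_vertex :: "bool \<Rightarrow> nat \<Rightarrow> tree \<Rightarrow> trie \<Rightarrow> unit list \<Rightarrow> nat list \<Rightarrow> result list" where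
  "new_vertex True k T u (_ # n) om = (case recs om k u of None \<Rightarrow> [] | Some u \<Rightarrow> [Res (put k T) u n])"
| "new_vertex _ k T u n om = []"

definition results :: "bool \<Rightarrow> tree \<Rightarrow> nat \<Rightarrow> nat \<Rightarrow> trie \<Rightarrow> unit list \<Rightarrow> nat list \<Rightarrow> result list" where
  "results low T k K u n om = new_vertex low k T u n om @ maps (finish om n) (items T k K u)"

text \<open>The list of units is a unary counter of the vertices that have not been found yet.\<close>

datatype state = St tree tree trie "unit list"

definition cover :: "nat \<Rightarrow> tree \<Rightarrow> tree \<Rightarrow> trie \<Rightarrow> unit list \<Rightarrow> state list" where
  "cover k A B u n = (case adv A k u of None \<Rightarrow> [] | Some (A, u) \<Rightarrow> (case adv B k u of None \<Rightarrow> [] | Some (B, u) \<Rightarrow> [St A B u n]))"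

fun coverA :: "nat \<Rightarrow> tree \<Rightarrow> result \<Rightarrow> state list" where "coverA k B (Res A u n) = cover k A B u n"

fun coverB :: "nat \<Rightarrow> tree \<Rightarrow> result \<Rightarrow> state list" where "coverB k A (Res B u n) = cover k A B u n"

definition branch :: "bool \<Rightarrow> nat \<Rightarrow> nat \<Rightarrow> tree \<Rightarrow> tree \<Rightarrow> trie \<Rightarrow> unit list \<Rightarrow> state list" where
  "branch low k K A B u n = maps (coverA k B) (results low A k K u n (members B))
     @ maps (coverB k A) (results low B k K u n (members A))"

datatype level = Lev nat nat bool

text \<open>Beyond deficit 76 all heights have been reached, so a state that still misses vertices
  is dropped.\<close>

fun step :: "level \<Rightarrow> state \<Rightarrow> state list" where
  "step (Lev k K low) (St A B u n) = (if has k u then cover k A B u n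
     else if low \<or> n = [] then branch low k K A B u n else [])"

text \<open>A state that outlives the last level is not refuted, so \<open>True\<close> means that
  every branch has died.\<close>

primrec refuted :: "level list \<Rightarrow> state \<Rightarrow> bool" where
  "refuted [] s = False"
| "refuted (l # ls) s = list_all (refuted ls) (step l s)"

definition lev :: "nat \<Rightarrow> level" where "lev k = Lev k (153 - k) (k \<le> 76)"

text \<open>Deficit 1 can only come from a height 1, which symmetry places on the first side.
  Together with the two endpoints this makes 3 of the 18 vertices; deficits 0 and 1 are settled, and
  the search starts at 2.\<close>

definition init :: state where
  "init = St (Lf 0 [numeral num.One]) (Lf 0 []) (ins_num num.One Tip) [(), (), (), (), (), (), (), (), (), (), (), (), (), (), ()]"

section \<open>Soundness of the search\<close>

lemma mem_num_ins: "mem_num m (ins_num n u) = (m = n \<or> mem_num m u)"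
proof (induction n u arbitrary: m rule: ins_num.induct)
qed (case_tac m; simp)+

lemma has_ins: "0 < e \<Longrightarrow> has e' (ins e u) = (e' = e \<or> has e' u)"
  by (cases "e' = 0") (auto simp: has_def ins_def mem_num_ins num_of_nat_inverse dest: arg_cong[of _ _ nat_of_num])

section \<open>Determined pairs and heights of a partial tree\<close>

primrec det :: "tree \<Rightarrow> (nat \<times> nat) set" where
  "det (Lf r os) = {}"
| "det (Br r b l t os) = set (members l) \<times> set (members t) \<union> det l \<union> det t"

lemma det_members: "(x, y) \<in> det T \<Longrightarrow> x \<in> set (members T) \<and> y \<in> set (members T)"
  by (induction T) auto

type_synonym vertex = "bool \<times> nat"

definition pset :: "bool \<Rightarrow> (nat \<times> nat) set \<Rightarrow> vertex set set" where
  "pset s R = {{(s, x), (s, y)} |x y. (x, y) \<in> R}"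

lemma pset_Un: "pset s (R \<union> R') = pset s R \<union> pset s R'"
  by (auto simp: pset_def)

lemma in_pset: "{(s, x), (s, y)} \<in> pset s R \<longleftrightarrow> (x, y) \<in> R \<or> (y, x) \<in> R"
  by (auto simp: pset_def doubleton_eq_iff)

lemma image_pset: "(\<lambda>m. {(s, a), (s, m)}) ` A = pset s (A \<times> {a})"
  by (auto simp: pset_def)

primrec leaf :: "tree \<Rightarrow> bool" where
  "leaf (Lf r os) \<longleftrightarrow> True"
| "leaf (Br r b l t os) \<longleftrightarrow> False"

text \<open>The heights in \<open>low T\<close> were found in increasing order. A hanging tree with a single vertex is exempt: it is a
  branching vertex, found out of order.\<close>

primrec low :: "tree \<Rightarrow> nat set" where
  "low (Lf r os) = insert r (set os)"
| "low (Br r b l t os) = low l \<union> (if leaf t then {} else low t) \<union> set os"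

abbreviation low_hang :: "tree \<Rightarrow> nat set" where
  "low_hang t \<equiv> (if leaf t then {} else low t)"

lemma opens_members: "set (opens T) \<subseteq> set (members T)" by (cases T) auto

lemma put_simps [simp]:
  "set (members (put x T)) = insert x (set (members T))"
  "det (put x T) = det T" "rep (put x T) = rep T" "opens (put x T) = opens T @ [x]" "leaf (put x T) = leaf T" "low (put x T) = insert x (low T)"
  by (cases T; auto)+

definition deficit :: "(bool \<Rightarrow> nat \<Rightarrow> nat \<Rightarrow> nat) \<Rightarrow> vertex \<Rightarrow> vertex \<Rightarrow> nat" where
  "deficit z p q = (if fst p = fst q then 153 + snd p + snd q - 2 * z (fst p) (snd p) (snd q) else snd p + snd q)"

text \<open>\<open>X s\<close> is the set of heights on the side \<open>s\<close>, and \<open>z s x y\<close> is the height of the median of \<open>x\<close>, \<open>y\<close> and the far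
  endpoint of the diameter.\<close>

locale solution =
  fixes X :: "bool \<Rightarrow> nat set" and z :: "bool \<Rightarrow> nat \<Rightarrow> nat \<Rightarrow> nat"
  assumes height: "x \<in> X s \<Longrightarrow> x \<le> 76"
    and zero: "0 \<in> X s"
    and card: "card (X True) + card (X False) = 18"
    and z_in: "\<lbrakk>x \<in> X s; y \<in> X s\<rbrakk> \<Longrightarrow> z s x y \<in> X s"
    and z_same: "x \<in> X s \<Longrightarrow> z s x x = x"
    and z_sym: "\<lbrakk>x \<in> X s; y \<in> X s\<rbrakk> \<Longrightarrow> z s x y = z s y x"
    and z_ge: "\<lbrakk>x \<in> X s; y \<in> X s\<rbrakk> \<Longrightarrow> x \<le> z s x y"
    and z_absorb: "\<lbrakk>x \<in> X s; y \<in> X s\<rbrakk> \<Longrightarrow> z s x (z s x y) = z s x y"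
    and ultra: "\<lbrakk>x \<in> X s; y \<in> X s; w \<in> X s\<rbrakk> \<Longrightarrow> z s x y \<le> max (z s x w) (z s w y)"
    and deficit_inj: "\<lbrakk>snd p \<in> X (fst p); snd q \<in> X (fst q); p \<noteq> q; snd p' \<in> X (fst p'); snd q' \<in> X (fst q'); p' \<noteq> q';
        deficit z p q = deficit z p' q'\<rbrakk> \<Longrightarrow> {p, q} = {p', q'}"
    and deficit_surj: "k < 153 \<Longrightarrow> \<exists>p q. snd p \<in> X (fst p) \<and> snd q \<in> X (fst q) \<and> p \<noteq> q \<and> deficit z p q = k"
begin

abbreviation "dd \<equiv> deficit z"
lemmas dd_def = deficit_def

definition valid :: "vertex \<Rightarrow> bool" where "valid p \<longleftrightarrow> snd p \<in> X (fst p)"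

lemma inj: "\<lbrakk>valid p; valid q; p \<noteq> q; valid p'; valid q'; p' \<noteq> q'; dd p q = dd p' q'\<rbrakk> \<Longrightarrow> {p, q} = {p', q'}"
  unfolding valid_def by (rule deficit_inj)

lemma surj: "k < 153 \<Longrightarrow> \<exists>p q. valid p \<and> valid q \<and> p \<noteq> q \<and> dd p q = k"
  unfolding valid_def by (rule deficit_surj)

definition pairs :: "vertex set set" where
  "pairs = {{p, q} |p q. valid p \<and> valid q \<and> p \<noteq> q}"

definition recorded :: "vertex set set \<Rightarrow> trie \<Rightarrow> bool" where
  "recorded P u \<longleftrightarrow> P \<subseteq> pairs \<and> (\<forall>e. has e u \<longleftrightarrow> (\<exists>p q. {p, q} \<in> P \<and> dd p q = e))"

lemma dd_same: "dd (s, x) (s, y) + 2 * z s x y = 153 + x + y" if "x \<in> X s" "y \<in> X s"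
  using height[OF z_in[OF that]] by (simp add: dd_def)

lemma dd_diff: "s \<noteq> t \<Longrightarrow> dd (s, x) (t, y) = x + y"
  by (simp add: dd_def)

lemma dd_sym: "valid p \<Longrightarrow> valid q \<Longrightarrow> dd p q = dd q p"
  by (auto simp: dd_def valid_def z_sym)

lemma pair_eqD: "\<lbrakk>{p, q} \<in> pairs; {p', q'} \<in> pairs; dd p q = dd p' q'\<rbrakk> \<Longrightarrow> {p, q} = {p', q'}"
proof -
  assume a: "{p, q} \<in> pairs" "{p', q'} \<in> pairs" "dd p q = dd p' q'"
  have "valid p \<and> valid q \<and> p \<noteq> q" if "{p, q} \<in> pairs" for p q
    using that by (auto simp: pairs_def doubleton_eq_iff)
  from this[OF a(1)] this[OF a(2)] show ?thesis using inj a(3) by blast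
qed

lemma in_pairs: "{p, q} \<in> pairs \<longleftrightarrow> valid p \<and> valid q \<and> p \<noteq> q"
  by (cases p; cases q; auto simp: pairs_def doubleton_eq_iff)

lemma recorded_fresh:
  assumes "recorded P u" "{p, q} \<in> pairs" "{p, q} \<notin> P"
  shows "\<not> has (dd p q) u"
proof
  assume "has (dd p q) u"
  then obtain p' q' where p: "{p', q'} \<in> P" "dd p' q' = dd p q"
    using assms(1) by (auto simp: recorded_def)
  then have "{p', q'} \<in> pairs" using assms(1) by (auto simp: recorded_def)
  then have "{p', q'} = {p, q}" using assms(2) p(2) by (rule pair_eqD)
  then show False using p(1) assms(3) by simp
qed

lemma has_mono: "\<lbrakk>has e u; recorded P u; recorded (P \<union> P') u'\<rbrakk> \<Longrightarrow> has e u'"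
  by (auto simp: recorded_def)

text \<open>For a genuine solution the entries never collide, because distinct pairs have distinct
  deficits. Failure of \<open>recs\<close> is therefore a sound reason to drop a branch.\<close>

lemma recs_recorded:
  assumes "recorded P u" "distinct ms" "\<And>m. m \<in> set ms \<Longrightarrow> {p, (s, m)} \<in> pairs - P \<and> dd p (s, m) = c + m"
  shows "\<exists>u'. recs ms c u = Some u' \<and> recorded (P \<union> (\<lambda>m. {p, (s, m)}) ` set ms) u'"
  using assms
proof (induction ms arbitrary: P u)
  case Nil
  then show ?case by simp
next
  case (Cons m ms)
  have m: "{p, (s, m)} \<in> pairs" "{p, (s, m)} \<notin> P" "dd p (s, m) = c + m" using Cons.prems(3)[of m] by auto
  have fresh: "\<not> has (c + m) u"
    using recorded_fresh[OF Cons.prems(1) m(1,2)] m(3) by simp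
  then have pos: "0 < c + m" by (auto simp: has_def intro: Nat.gr0I)
  have rec: "recorded (insert {p, (s, m)} P) (ins (c + m) u)"
    unfolding recorded_def
  proof (intro conjI allI)
    show "insert {p, (s, m)} P \<subseteq> pairs" using Cons.prems(1) m(1) by (auto simp: recorded_def)
    fix e
    have sym: "dd p' q' = c + m" if "{p', q'} = {p, (s, m)}" for p' q'
      using that m dd_sym[of p "(s, m)"] by (auto simp: doubleton_eq_iff in_pairs)
    have "has e (ins (c + m) u) \<longleftrightarrow> e = c + m \<or> has e u" using pos by (rule has_ins)
    also have "\<dots> \<longleftrightarrow> e = c + m \<or> (\<exists>p q. {p, q} \<in> P \<and> dd p q = e)"
      using Cons.prems(1) by (auto simp: recorded_def)
    also have "\<dots> \<longleftrightarrow> (\<exists>p' q'. {p', q'} \<in> insert {p, (s, m)} P \<and> dd p' q' = e)"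
      using sym m(3) by (metis insert_iff)
    finally show "has e (ins (c + m) u) \<longleftrightarrow> (\<exists>p' q'. {p', q'} \<in> insert {p, (s, m)} P \<and> dd p' q' = e)" .
  qed
  have "\<exists>u'. recs ms c (ins (c + m) u) = Some u' \<and> recorded (insert {p, (s, m)} P \<union> (\<lambda>m. {p, (s, m)}) ` set ms) u'"
  proof (rule Cons.IH[OF rec])
    show "distinct ms" using Cons.prems(2) by simp
    fix m' assume m': "m' \<in> set ms"
    then have "m' \<noteq> m" using Cons.prems(2) by auto
    then have "{p, (s, m')} \<noteq> {p, (s, m)}" by (auto simp: doubleton_eq_iff)
    then show "{p, (s, m')} \<in> pairs - insert {p, (s, m)} P \<and> dd p (s, m') = c + m'"
      using Cons.prems(3)[of m'] m' by auto
  qed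
  then show ?case using fresh by auto
qed

section \<open>Ultrametric invariants of a partial tree\<close>

lemma z_trichotomy:
  assumes "x \<in> X s" "y \<in> X s" "w \<in> X s" "z s w x < z s w y"
  shows "z s x y = z s w y"
\<comment> \<open>In an ultrametric triangle the two longest sides agree.\<close>
proof (rule antisym)
  show "z s x y \<le> z s w y"
    using ultra[of x s y w] assms z_sym[of x s w] by auto
  show "z s w y \<le> z s x y"
    using ultra[of w s y x] assms by auto
qed

text \<open>A height \<open>x\<close> is open at \<open>r\<close> as long as its deficit with \<open>r\<close> is not covered, that is, as long as its median
  with \<open>r\<close> is not too high.\<close>

definition open_ok :: "bool \<Rightarrow> nat \<Rightarrow> nat \<Rightarrow> nat \<Rightarrow> bool" where
  "open_ok s k r x \<longleftrightarrow> x \<in> X s \<and> r < x \<and> k \<le> dd (s, r) (s, x)"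

text \<open>The branching vertex is always a vertex of the tree and is kept in the hanging part
  \<open>t\<close>. A hanging leaf is that vertex alone, without open heights, which
  \<open>split_off\<close> relies on.\<close>

definition split_ok :: "bool \<Rightarrow> nat \<Rightarrow> nat \<Rightarrow> tree \<Rightarrow> tree \<Rightarrow> bool" where
  "split_ok s r b l t \<longleftrightarrow>
     (\<exists>c. b + 2 * c = 153 \<and> c \<in> set (members t)
        \<and> (\<forall>x\<in>set (members l). z s r x < c \<and> (\<forall>y\<in>set (members t). z s x y = c))
        \<and> (\<forall>y\<in>set (members t). r < y)
        \<and> (leaf t \<longrightarrow> members t = [c]))"

text \<open>\<open>k \<le> b + r + x\<close> says that no open height is overdue for moving down.
  The last conjunct allows an open height to be appended to the queue of a subtree without breaking
  its order; nothing is ever appended to a hanging leaf, hence \<open>low_hang\<close>.\<close>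

primrec sat :: "bool \<Rightarrow> nat \<Rightarrow> tree \<Rightarrow> bool" where
  "sat s k (Lf r os) \<longleftrightarrow> r \<in> X s \<and> sorted_wrt (<) os \<and> (\<forall>x\<in>set os. open_ok s k r x)"
| "sat s k (Br r b l t os) \<longleftrightarrow> sat s k l \<and> sat s k t \<and> r = rep l \<and> sorted_wrt (<) os
     \<and> (\<forall>x\<in>set os. open_ok s k r x \<and> k \<le> b + r + x)
     \<and> set (members l) \<inter> set (members t) = {} \<and> set os \<inter> (set (members l) \<union> set (members t)) = {}
     \<and> split_ok s r b l t \<and> (\<forall>x\<in>set os. \<forall>y\<in>low l \<union> low_hang t. y < x)"

lemma sat_members: "sat s k T \<Longrightarrow> set (members T) \<subseteq> X s \<and> distinct (members T) \<and> rep T \<in> set (members T) \<and> (\<forall>x\<in>set (members T). rep T \<le> x)"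
proof (induction T)
  case (Lf r os)
  then show ?case by (auto simp: open_ok_def strict_sorted_iff)
next
  case (Br r b l t os)
  then have l: "sat s k l" and t: "sat s k t" and r: "r = rep l" and so: "sorted_wrt (<) os" and
    o: "\<forall>x\<in>set os. open_ok s k r x" and d: "set (members l) \<inter> set (members t) = {}" "set os \<inter> (set (members l) \<union> set (members t)) = {}"
    and sp: "split_ok s r b l t" by auto
  from so have "distinct os" by (simp add: strict_sorted_iff)
  moreover have "\<forall>y\<in>set (members t). r < y" using sp by (auto simp: split_ok_def)
  ultimately show ?case using Br.IH(1)[OF l] Br.IH(2)[OF t] d r o
    by (auto simp: open_ok_def less_imp_le)
qed

lemma sat_opens: "sat s k T \<Longrightarrow> sorted_wrt (<) (opens T) \<and> (\<forall>x\<in>set (opens T). open_ok s k (rep T) x)"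
  by (cases T) auto

section \<open>Soundness of passing a deficit\<close>

definition outside :: "bool \<Rightarrow> nat set \<Rightarrow> vertex set set \<Rightarrow> bool" where
  "outside s M Q \<longleftrightarrow> (\<forall>x\<in>M. \<forall>y\<in>M. {(s, x), (s, y)} \<notin> Q)"

lemma sat_put:
  assumes "sat s k T" "open_ok s k (rep T) x" "x \<notin> set (members T)" "\<forall>y\<in>low T. y < x"
    and "\<And>r b l t os. T = Br r b l t os \<Longrightarrow> k \<le> b + r + x"
  shows "sat s k (put x T)"
  using assms by (cases T) (auto simp: sorted_wrt_append)

lemma split_ok_cong:
  assumes "split_ok s r b l t" "set (members l') = set (members l)" "set (members t') = set (members t)"
    "leaf t' = leaf t" "leaf t \<longrightarrow> t' = t"
  shows "split_ok s r b l' t'"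
  using assms unfolding split_ok_def by metis

lemma adv_top_ok:
  assumes l: "sat s (Suc k) l" and t: "sat s (Suc k) t" and r: "r = rep l" and so: "sorted_wrt (<) os"
    and os: "\<forall>x\<in>set os. open_ok s k r x \<and> k \<le> b + r + x"
    and disj: "set (members l) \<inter> set (members t) = {}" "set os \<inter> (set (members l) \<union> set (members t)) = {}"
    and sp: "split_ok s r b l t" and low: "\<forall>x\<in>set os. \<forall>y\<in>low l \<union> low_hang t. y < x"
    and out: "outside s (set (members (Br r b l t os))) Q"
    and rec: "recorded (Q \<union> pset s (det (Br r b l t os))) u"
    and cov: "has k u"
  shows "\<exists>l' t' os' u'. adv_top k r b l t os u = Some (Br r b l' t' os', u') \<and> sat s (Suc k) (Br r b l' t' os')
     \<and> set (members (Br r b l' t' os')) = set (members (Br r b l t os)) \<and> low (Br r b l' t' os') \<subseteq> low (Br r b l t os)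
     \<and> recorded (Q \<union> pset s (det (Br r b l' t' os'))) u' \<and> has k u'
     \<and> det (Br r b l t os) \<subseteq> det (Br r b l' t' os')"
proof -
  let ?T = "Br r b l t os"
  obtain c where c: "b + 2 * c = 153" "c \<in> set (members t)" "\<forall>x\<in>set (members l). z s r x < c \<and> (\<forall>y\<in>set (members t). z s x y = c)"
    "\<forall>y\<in>set (members t). r < y" using sp by (auto simp: split_ok_def)
  note lm = sat_members[OF l] and tm = sat_members[OF t]
  have rX: "r \<in> X s" "r \<in> set (members l)" using lm r by auto
  \<comment> \<open>The pair \<open>r\<close>, \<open>x\<close> is not recorded although
    \<open>k\<close> is, so its deficit differs from \<open>k\<close> and the bound becomes
    strict.\<close>
  have open1: "open_ok s (Suc k) r x" if "x \<in> set os" for x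
  proof -
    have x: "x \<in> X s" "r < x" "k \<le> dd (s, r) (s, x)" using os that by (auto simp: open_ok_def)
    have "{(s, r), (s, x)} \<in> pairs" using x rX by (simp add: in_pairs valid_def)
    moreover have "{(s, r), (s, x)} \<notin> Q \<union> pset s (det ?T)"
    proof -
      have "(r, x) \<notin> det ?T" "(x, r) \<notin> det ?T"
        using that disj det_members by fastforce+
      then show ?thesis using out that rX by (auto simp: outside_def in_pset)
    qed
    ultimately have "\<not> has (dd (s, r) (s, x)) u" using recorded_fresh[OF rec] by blast
    with cov x(3) have "dd (s, r) (s, x) \<noteq> k" by auto
    with x show ?thesis by (simp add: open_ok_def)
  qed
  show ?thesis
  proof (cases "\<exists>x xs. os = x # xs \<and> b + r + x = k")
    case False
    have "Suc k \<le> b + r + x" if "x \<in> set os" for x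
    proof (cases os)
      case (Cons y ys)
      with False os have "k < b + r + y" by force
      moreover have "y \<le> x" using that so Cons by auto
      ultimately show ?thesis by simp
    qed (use that in simp)
    then have "sat s (Suc k) ?T" using l t r so disj sp low open1 by simp
    moreover have "adv_top k r b l t os u = Some (?T, u)" using False by (auto simp: adv_top_def split: list.splits)
    ultimately show ?thesis using rec cov by blast
  next
    case True
    then obtain x xs where x: "os = x # xs" "b + r + x = k" by auto
    have xo: "open_ok s (Suc k) r x" using open1 x by simp
    have xX: "x \<in> X s" "r < x" using xo by (auto simp: open_ok_def)
    have dk: "Suc k \<le> dd (s, r) (s, x)" using xo by (simp add: open_ok_def)
    have zrx: "z s r x < c" using dd_same[OF rX(1) xX(1)] dk c(1) x(2) by simp
    have zxy: "z s x y = c" if "y \<in> set (members t)" for y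
    proof -
      have "y \<in> X s" using that tm by auto
      moreover have "z s r y = c" using c(3) rX that by auto
      ultimately show ?thesis using z_trichotomy[of x s y r] zrx xX rX by auto
    qed
    let ?l = "put x l"
    have xl: "x \<notin> set (members l)" "x \<notin> set (members t)" using disj x by auto
    have satl: "sat s (Suc k) ?l"
    proof (rule sat_put[OF l])
      show "open_ok s (Suc k) (rep l) x" using xo r by simp
      show "\<forall>y\<in>low l. y < x" using low x by simp
      fix r2 b2 l2 t2 os2 assume l2: "l = Br r2 b2 l2 t2 os2"
      then have r2: "r2 = r" using r by simp
      \<comment> \<open>The branching vertices met on the way up from \<open>r\<close> have
        increasing heights: \<open>c2 < c\<close>, so the label \<open>b2\<close> is larger than
        \<open>b\<close>, and \<open>x\<close> is not overdue in the subtree that it enters.\<close>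
      obtain c2 where c2: "b2 + 2 * c2 = 153" "c2 \<in> set (members t2)" "\<forall>x\<in>set (members l2). z s r2 x < c2 \<and> (\<forall>y\<in>set (members t2). z s x y = c2)"
        using l l2 by (auto simp: split_ok_def)
      have "r \<in> set (members l2)" using l l2 r2 sat_members[of s "Suc k" l2] by auto
      then have "z s r c2 = c2" using c2 by auto
      moreover have "c2 \<in> set (members l)" using c2 l2 by auto
      ultimately have "c2 < c" using c(3) by metis
      then show "Suc k \<le> b2 + r2 + x" using c(1) c2(1) r2 x(2) by simp
    qed (use xl in auto)
    have ex: "\<exists>u'. recs (members t) (b + x) u = Some u' \<and> recorded ((Q \<union> pset s (det ?T)) \<union> (\<lambda>m. {(s, x), (s, m)}) ` set (members t)) u'"
    proof (rule recs_recorded[OF rec])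
      show "distinct (members t)" using tm by simp
      fix m assume m: "m \<in> set (members t)"
      have mX: "m \<in> X s" using m tm by auto
      have "x \<noteq> m" using m xl by auto
      then have "{(s, x), (s, m)} \<in> pairs" using xX mX by (simp add: in_pairs valid_def)
      moreover have "(x, m) \<notin> det ?T" "(m, x) \<notin> det ?T" using xl det_members by fastforce+
      then have "{(s, x), (s, m)} \<notin> Q \<union> pset s (det ?T)" using out m x by (auto simp: outside_def in_pset)
      moreover have "dd (s, x) (s, m) = b + x + m" using dd_same[OF xX(1) mX] zxy[OF m] c(1) by simp
      ultimately show "{(s, x), (s, m)} \<in> pairs - (Q \<union> pset s (det ?T)) \<and> dd (s, x) (s, m) = b + x + m" by simp
    qed
    then obtain u' where u': "recs (members t) (b + x) u = Some u'"
      "recorded ((Q \<union> pset s (det ?T)) \<union> (\<lambda>m. {(s, x), (s, m)}) ` set (members t)) u'" by blast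
    have eq: "(Q \<union> pset s (det ?T)) \<union> (\<lambda>m. {(s, x), (s, m)}) ` set (members t) = Q \<union> pset s (det (Br r b ?l t xs))"
      by (auto simp: pset_def)
    have sp': "split_ok s r b ?l t"
      unfolding split_ok_def
      by (rule exI[of _ c]) (use c zrx zxy sp in \<open>auto simp: split_ok_def\<close>)
    have "sat s (Suc k) (Br r b ?l t xs)"
    proof -
      have "\<forall>y\<in>set xs. open_ok s (Suc k) r y \<and> Suc k \<le> b + r + y" using open1 so x by auto
      moreover have "\<forall>y\<in>set xs. \<forall>w\<in>low ?l \<union> low_hang t. w < y" using low so x by auto
      moreover have "sorted_wrt (<) xs" using so x by simp
      moreover have "set (members ?l) \<inter> set (members t) = {}" "set xs \<inter> (set (members ?l) \<union> set (members t)) = {}"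
        using disj xl x so by auto
      ultimately show ?thesis using satl t r sp' by simp
    qed
    moreover have "adv_top k r b l t os u = Some (Br r b ?l t xs, u')" using x u' by (simp add: adv_top_def)
    moreover have "low (Br r b ?l t xs) \<subseteq> low ?T" "set (members (Br r b ?l t xs)) = set (members ?T)"
      "det ?T \<subseteq> det (Br r b ?l t xs)" using x by auto
    ultimately show ?thesis using u'(2) has_mono[OF cov rec u'(2)] unfolding eq by blast
  qed
qed

lemma outside_Un: "outside s M (Q \<union> Q') \<longleftrightarrow> outside s M Q \<and> outside s M Q'"
  by (auto simp: outside_def)

lemma outside_pset: "outside s M (pset s R) \<longleftrightarrow> (\<forall>x\<in>M. \<forall>y\<in>M. (x, y) \<notin> R)"
  by (auto simp: outside_def in_pset)

text \<open>\<open>Q\<close> stands for everything recorded elsewhere. It is kept arbitrary so that,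
  in a node, the pairs between the subtrees and those within the sibling can be moved into it;
  \<open>outside\<close> ensures that it has no pair of the present subtree.\<close>

lemma adv_ok:
  assumes "sat s k T" "outside s (set (members T)) Q" "recorded (Q \<union> pset s (det T)) u" "has k u"
  shows "\<exists>T' u'. adv T k u = Some (T', u') \<and> sat s (Suc k) T' \<and> rep T' = rep T \<and> set (members T') = set (members T)
     \<and> low T' \<subseteq> low T \<and> leaf T' = leaf T \<and> (leaf T \<longrightarrow> T' = T) \<and> has k u' \<and> det T \<subseteq> det T'
     \<and> recorded (Q \<union> pset s (det T')) u'"
  using assms
proof (induction T arbitrary: Q u)
  case (Lf r os)
  have "open_ok s (Suc k) r x" if "x \<in> set os" for x
  proof -
    have x: "x \<in> X s" "r < x" "k \<le> dd (s, r) (s, x)" "r \<in> X s" using Lf.prems(1) that by (auto simp: open_ok_def)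
    then have "{(s, r), (s, x)} \<in> pairs" by (simp add: in_pairs valid_def)
    moreover have "{(s, r), (s, x)} \<notin> Q \<union> pset s (det (Lf r os))"
      using Lf.prems(2) that by (auto simp: outside_def pset_def)
    ultimately have "\<not> has (dd (s, r) (s, x)) u" using recorded_fresh[OF Lf.prems(3)] by blast
    with Lf.prems(4) x show ?thesis by (metis open_ok_def Suc_leI le_neq_implies_less)
  qed
  then show ?case using Lf.prems by simp
next
  case (Br r b l t os)
  let ?L = "set (members l)" and ?M = "set (members t)"
  have l: "sat s k l" and t: "sat s k t" and r: "r = rep l" and so: "sorted_wrt (<) os"
    and os: "\<forall>x\<in>set os. open_ok s k r x \<and> k \<le> b + r + x"
    and disj: "?L \<inter> ?M = {}" "set os \<inter> (?L \<union> ?M) = {}"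
    and sp: "split_ok s r b l t" and low: "\<forall>x\<in>set os. \<forall>y\<in>low l \<union> low_hang t. y < x"
    using Br.prems(1) by auto
  define Ql where "Ql = Q \<union> pset s (?L \<times> ?M) \<union> pset s (det t)"
  have outl: "outside s ?L Ql"
    unfolding Ql_def outside_Un outside_pset using Br.prems(2) disj det_members[of _ _ t]
    by (auto simp: outside_def)
  have e1: "Q \<union> pset s (det (Br r b l t os)) = Ql \<union> pset s (det l)"
    by (simp add: Ql_def pset_Un Un_ac)
  obtain l' u1 where 1: "adv l k u = Some (l', u1)" "sat s (Suc k) l'" "rep l' = rep l" "set (members l') = ?L"
     "low l' \<subseteq> low l" "leaf l' = leaf l" "leaf l \<longrightarrow> l' = l" "has k u1" "det l \<subseteq> det l'" "recorded (Ql \<union> pset s (det l')) u1"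
    using Br.IH(1)[OF l outl Br.prems(3)[unfolded e1] Br.prems(4)] by blast
  define Qt where "Qt = Q \<union> pset s (?L \<times> ?M) \<union> pset s (det l')"
  have outt: "outside s ?M Qt"
    unfolding Qt_def outside_Un outside_pset using Br.prems(2) disj det_members[of _ _ l'] 1(4)
    by (auto simp: outside_def)
  have e2: "Ql \<union> pset s (det l') = Qt \<union> pset s (det t)"
    by (simp add: Ql_def Qt_def Un_ac)
  obtain t' u2 where 2: "adv t k u1 = Some (t', u2)" "sat s (Suc k) t'" "rep t' = rep t" "set (members t') = ?M"
     "low t' \<subseteq> low t" "leaf t' = leaf t" "leaf t \<longrightarrow> t' = t" "has k u2" "det t \<subseteq> det t'" "recorded (Qt \<union> pset s (det t')) u2"
    using Br.IH(2)[OF t outt 1(10)[unfolded e2] 1(8)] by blast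
  have e3: "Qt \<union> pset s (det t') = Q \<union> pset s (det (Br r b l' t' os))"
    by (simp add: Qt_def pset_Un 1(4) 2(4) Un_ac)
  have lh: "low_hang t' \<subseteq> low_hang t" using 2(5,6) by simp
  have "\<exists>l'' t'' os' u'. adv_top k r b l' t' os u2 = Some (Br r b l'' t'' os', u') \<and> sat s (Suc k) (Br r b l'' t'' os')
     \<and> set (members (Br r b l'' t'' os')) = set (members (Br r b l' t' os)) \<and> low (Br r b l'' t'' os') \<subseteq> low (Br r b l' t' os)
     \<and> recorded (Q \<union> pset s (det (Br r b l'' t'' os'))) u' \<and> has k u'
     \<and> det (Br r b l' t' os) \<subseteq> det (Br r b l'' t'' os')"
  proof (rule adv_top_ok[OF 1(2) 2(2) _ so os])
    show "r = rep l'" using r 1 by simp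
    show "set (members l') \<inter> set (members t') = {}" "set os \<inter> (set (members l') \<union> set (members t')) = {}" using disj 1 2 by auto
    show "split_ok s r b l' t'" by (rule split_ok_cong[OF sp]) (use 1 2 in auto)
    show "\<forall>x\<in>set os. \<forall>y\<in>low l' \<union> low_hang t'. y < x" using low 1(5) lh by blast
    show "outside s (set (members (Br r b l' t' os))) Q" using Br.prems(2) 1(4) 2(4) by simp
    show "recorded (Q \<union> pset s (det (Br r b l' t' os))) u2" using 2(10) e3 by simp
    show "has k u2" by (rule 2(8))
  qed
  then obtain l'' t'' os' u' where 3: "adv_top k r b l' t' os u2 = Some (Br r b l'' t'' os', u')" "sat s (Suc k) (Br r b l'' t'' os')"
     "set (members (Br r b l'' t'' os')) = set (members (Br r b l' t' os))" "low (Br r b l'' t'' os') \<subseteq> low (Br r b l' t' os)"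
     "recorded (Q \<union> pset s (det (Br r b l'' t'' os'))) u'" "has k u'" "det (Br r b l' t' os) \<subseteq> det (Br r b l'' t'' os')" by blast
  have "adv (Br r b l t os) k u = Some (Br r b l'' t'' os', u')" using 1(1) 2(1) 3(1) by simp
  moreover have "low (Br r b l' t' os) \<subseteq> low (Br r b l t os)" using 1(5) lh by (simp only: low.simps) blast
  with 3(4) have "low (Br r b l'' t'' os') \<subseteq> low (Br r b l t os)" by (rule subset_trans)
  moreover have "det (Br r b l t os) \<subseteq> det (Br r b l' t' os)" using 1(4,9) 2(4,9) by auto
  with 3(7) have "det (Br r b l t os) \<subseteq> det (Br r b l'' t'' os')" by (rule subset_trans[rotated])
  ultimately show ?case using 3(2,3,5,6) 1(4) 2(4) by auto
qed

section \<open>Soundness of the branches within one side\<close>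

definition tree_ok :: "bool \<Rightarrow> nat \<Rightarrow> tree \<Rightarrow> vertex set set \<Rightarrow> nat set \<Rightarrow> tree \<Rightarrow> trie \<Rightarrow> bool" where
  "tree_ok s k T Q M T' u \<longleftrightarrow> sat s k T' \<and> rep T' = rep T \<and> set (members T') = M \<and> low T' \<subseteq> low T \<and> \<not> leaf T'
     \<and> has k u \<and> det T \<subseteq> det T' \<and> recorded (Q \<union> pset s (det T')) u"

fun item_ok :: "bool \<Rightarrow> nat \<Rightarrow> tree \<Rightarrow> vertex set set \<Rightarrow> nat \<Rightarrow> item \<Rightarrow> bool" where
  "item_ok s k T Q v (Done T' u) \<longleftrightarrow> tree_ok s k T Q (set (members T)) T' u"
| "item_ok s k T Q v (Pend w T' u) \<longleftrightarrow> w = v \<and> v \<notin> set (members T) \<and> tree_ok s k T Q (insert v (set (members T))) T' u"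

lemma open_not_det:
  assumes "sat s k T" "x \<in> set (opens T)"
  shows "(x, m) \<notin> det T" "(m, x) \<notin> det T"
  using assms det_members by (cases T; fastforce)+

lemma with_open_simps [simp]:
  "rep (with_open os T) = rep T" "opens (with_open os T) = os" "det (with_open os T) = det T"
  by (cases T; simp)+

text \<open>As \<open>r\<close> and \<open>x\<close> own \<open>k\<close>, their median
  \<open>v\<close> satisfies \<open>lab v + r + x = k\<close>. The assumption on branches therefore
  says that \<open>v\<close> lies above the topmost branching vertex, which makes a node on top of
  \<open>S\<close> the right place.\<close>

lemma attach_ok:
  assumes T: "sat s k T" and op: "opens T = lo @ x # hi" and r: "r = rep T" and dk: "dd (s, r) (s, x) = k"
    and ev: "\<And>r b l t os. T = Br r b l t os \<Longrightarrow> k < b + r + x"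
    and out: "outside s (set (members T)) Q" and rec: "recorded (Q \<union> pset s (det T)) u"
    and v: "v = z s r x" and new: "v \<notin> set (members T) \<Longrightarrow> \<forall>m\<in>set (members T). {(s, v), (s, m)} \<notin> Q"
  shows "\<exists>i\<in>set (attach r (with_open lo T) x hi v u). item_ok s k T Q v i"
proof -
  define S where "S = with_open lo T"
  define M where "M = set (members S)"
  note Tm = sat_members[OF T] and To = sat_opens[OF T]
  have so: "sorted_wrt (<) lo" "sorted_wrt (<) hi" "\<forall>y\<in>set lo. y < x" "\<forall>y\<in>set hi. x < y" "\<forall>y\<in>set lo. \<forall>w\<in>set hi. y < w"
    using To op by (auto simp: sorted_wrt_append)
  have xo: "open_ok s k r x" "\<forall>y\<in>set lo \<union> set hi. open_ok s k r y" using To op r by auto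
  have rX: "r \<in> X s" using Tm r by auto
  have xX: "x \<in> X s" "r < x" using xo by (auto simp: open_ok_def)
  have memT: "set (members T) = M \<union> {x} \<union> set hi"
    using op by (cases T) (auto simp: M_def S_def)
  have disj: "x \<notin> M" "set hi \<inter> M = {}" "distinct (members S)"
  proof -
    have "distinct (members S @ x # hi)" using conjunct1[OF conjunct2[OF Tm]] op by (cases T) (auto simp: S_def)
    then show "x \<notin> M" "set hi \<inter> M = {}" "distinct (members S)" by (auto simp: M_def)
  qed
  have satS: "sat s k S" using T op by (cases T) (auto simp: S_def sorted_wrt_append)
  have rM: "r \<in> M" using sat_members[OF satS] r by (simp add: M_def S_def)
  have MX: "M \<subseteq> X s" using sat_members[OF satS] by (simp add: M_def)
  have vX: "v \<in> X s" using z_in rX xX v by simp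
  have v76: "v \<le> 76" using height[OF vX] .
  have lab: "lab v + 2 * v = 153" using v76 by (simp add: lab_def)
  have xv: "x \<le> v" using z_ge[OF xX(1) rX] z_sym[OF rX xX(1)] v by simp
  have kv: "lab v + r + x = k" using dd_same[OF rX xX(1)] dk v lab by simp
  \<comment> \<open>A smaller open height has deficit at least \<open>k\<close> with
    \<open>r\<close>, which forces a lower median; the members of a branch meet \<open>r\<close> no
    higher than the old branching vertex, which is below \<open>v\<close>.\<close>
  have zr: "z s r m < v" if mM: "m \<in> M" for m
  proof -
    consider "m = r" | "m \<in> set lo" | r' b l t os where "T = Br r' b l t os" "m \<in> set (members l) \<union> set (members t)"
      using mM r by (cases T) (auto simp: M_def S_def)
    then show ?thesis
    proof cases
      case 1
      then show ?thesis using z_same rX xX xv by simp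
    next
      case 2
      then have m: "m \<in> X s" "m < x" "k \<le> dd (s, r) (s, m)" using xo so by (auto simp: open_ok_def)
      then show ?thesis using dd_same[OF rX m(1)] kv lab by simp
    next
      case (3 r' b l t os)
      then obtain c where c: "b + 2 * c = 153" "\<forall>x\<in>set (members l). z s r x < c \<and> (\<forall>y\<in>set (members t). z s x y = c)"
        using T r by (auto simp: split_ok_def)
      have "r \<in> set (members l)" using T 3(1) r sat_members[of s k l] by auto
      then have "z s r m \<le> c" using c(2) 3(2) by fastforce
      moreover have "k < b + r + x" using ev[OF 3(1)] 3(1) r by simp
      ultimately show ?thesis using c(1) kv lab by simp
    qed
  qed
  have zx: "z s m x = v" if "m \<in> M" for m
    using z_trichotomy[of m s x r] zr[OF that] that MX rX xX v by auto
  have vM: "v \<notin> M"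
    using zr[of v] z_absorb[OF rX xX(1)] v by auto
  have zv: "z s m v = v" if "m \<in> insert x M" for m
  proof (cases "m = x")
    case True
    then show ?thesis using z_absorb[OF xX(1) rX] z_sym[OF rX xX(1)] v by simp
  next
    case False
    have "z s r v = v" using z_absorb[OF rX xX(1)] v by simp
    then show ?thesis using z_trichotomy[of m s v r] zr[of m] that False MX rX vX by auto
  qed
  have "\<exists>u'. recs (members S) (lab v + x) u = Some u' \<and> recorded ((Q \<union> pset s (det T)) \<union> (\<lambda>m. {(s, x), (s, m)}) ` set (members S)) u'"
  proof (rule recs_recorded[OF rec disj(3)])
    fix m assume "m \<in> set (members S)"
    then have m: "m \<in> M" "m \<in> X s" "m \<noteq> x" using disj MX by (auto simp: M_def)
    have "{(s, x), (s, m)} \<in> pairs" using m xX by (simp add: in_pairs valid_def)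
    moreover have "{(s, x), (s, m)} \<notin> Q" using out m memT by (auto simp: outside_def)
    moreover have "{(s, x), (s, m)} \<notin> pset s (det T)" using open_not_det[OF T] op by (auto simp: in_pset)
    moreover have "dd (s, x) (s, m) = lab v + x + m" using dd_same[OF xX(1) m(2)] zx[OF m(1)] z_sym[OF m(2) xX(1)] lab by simp
    ultimately show "{(s, x), (s, m)} \<in> pairs - (Q \<union> pset s (det T)) \<and> dd (s, x) (s, m) = lab v + x + m" by simp
  qed
  then obtain u1 where u1: "recs (members S) (lab v + x) u = Some u1"
    "recorded (Q \<union> pset s (det T) \<union> pset s (M \<times> {x})) u1" by (auto simp: image_pset M_def)
  have hk: "has k u1"
    using u1(2) rM dk unfolding recorded_def by (metis (no_types, lifting) UnI2 in_pset mem_Sigma_iff singletonI)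
  have lowS: "\<forall>y\<in>set hi. \<forall>w\<in>low S. w < y"
  proof (cases T)
    case (Lf r' os)
    then show ?thesis using so xo r by (auto simp: S_def open_ok_def)
  next
    case (Br r' b l t os)
    then show ?thesis using T op so by (auto simp: S_def)
  qed
  have lowS': "low S \<union> {x} \<union> set hi \<subseteq> low T"
    using op by (cases T) (auto simp: S_def)
  have his: "\<forall>y\<in>set hi. open_ok s k r y \<and> k \<le> lab v + r + y" using xo so kv by auto
  have detS: "det S = det T" "rep S = r" by (simp_all add: S_def r)
  show ?thesis
  proof (cases "v = x")
    case True
    let ?T = "Br r (lab v) S (Lf v []) hi"
    have "split_ok s r (lab v) S (Lf v [])"
      unfolding split_ok_def by (rule exI[of _ v]) (use lab zr zx xX True in \<open>auto simp: M_def\<close>)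
    then have "sat s k ?T" using satS vX so his disj lowS True by (auto simp: M_def detS)
    moreover have "set (members ?T) = set (members T)" using memT True by (auto simp: M_def)
    moreover have "low ?T \<subseteq> low T" "det T \<subseteq> det ?T" using lowS' by (auto simp: detS)
    moreover have "Q \<union> pset s (det ?T) = Q \<union> pset s (det T) \<union> pset s (M \<times> {x})"
      by (simp add: pset_Un detS True M_def Un_ac)
    ultimately have "tree_ok s k T Q (set (members T)) ?T u1"
      using u1(2) hk r by (simp add: tree_ok_def del: sat.simps det.simps members.simps low.simps)
    moreover have "attach r S x hi v u = [Done ?T u1]" using u1(1) True by (simp add: attach_def)
    ultimately show ?thesis by (simp add: S_def)
  next
    case False
    then have xv: "x < v" using xv by simp
    have "\<exists>u'. recs (x # members S) (lab v + v) u1 = Some u' \<and> recorded ((Q \<union> pset s (det T) \<union> pset s (M \<times> {x})) \<union> (\<lambda>m. {(s, v), (s, m)}) ` set (x # members S)) u'"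
    proof (rule recs_recorded[OF u1(2)])
      show "distinct (x # members S)" using disj by (simp add: M_def)
      fix m assume "m \<in> set (x # members S)"
      then have m: "m \<in> insert x M" "m \<in> X s" "m \<in> set (members T)" using MX xX memT by (auto simp: M_def)
      have mv: "m \<noteq> v" using m vM False by auto
      have "{(s, v), (s, m)} \<in> pairs" using m vX mv by (simp add: in_pairs valid_def)
      moreover have "{(s, v), (s, m)} \<notin> Q"
      proof (cases "v \<in> set (members T)")
        case True
        then show ?thesis using out m by (auto simp: outside_def)
      qed (use new m in auto)
      moreover have "{(s, v), (s, m)} \<notin> pset s (det T)"
      proof (cases "v \<in> set (members T)")
        case True
        then have "v \<in> set (opens T)" using memT vM False op by auto
        then show ?thesis using open_not_det[OF T] by (auto simp: in_pset)
      qed (auto simp: in_pset dest: det_members)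
      moreover have "{(s, v), (s, m)} \<notin> pset s (M \<times> {x})" using vM False by (auto simp: in_pset)
      moreover have "dd (s, v) (s, m) = lab v + v + m" using dd_same[OF vX m(2)] zv[OF m(1)] z_sym[OF m(2) vX] lab by simp
      ultimately show "{(s, v), (s, m)} \<in> pairs - (Q \<union> pset s (det T) \<union> pset s (M \<times> {x})) \<and> dd (s, v) (s, m) = lab v + v + m" by simp
    qed
    then obtain u2 where u2: "recs (x # members S) (lab v + v) u1 = Some u2"
      "recorded (Q \<union> pset s (det T) \<union> pset s (M \<times> {x}) \<union> pset s (insert x M \<times> {v})) u2" by (auto simp only: image_pset M_def list.set)
    have hk2: "has k u2" using has_mono[OF hk u1(2) u2(2)] .
    let ?H = "Br x (lab v) (Lf x []) (Lf v []) []"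
    define T' where "T' = Br r (lab v) S ?H"
    have "split_ok s x (lab v) (Lf x []) (Lf v [])"
      unfolding split_ok_def by (rule exI[of _ v]) (use lab zv[of x] xv z_same[OF xX(1)] in auto)
    then have satH: "sat s k ?H" using xX vX xv by simp
    have sp: "split_ok s r (lab v) S ?H"
      unfolding split_ok_def by (rule exI[of _ v]) (use lab zr zx zv xX xv in \<open>auto simp: M_def\<close>)
    \<comment> \<open>One statement for both outcomes: \<open>os\<close> is \<open>hi\<close>, or
      \<open>hi\<close> without \<open>v\<close> if \<open>v\<close> was open at this node.\<close>
    have sat': "sat s k (T' os)" if "set os \<subseteq> set hi" "v \<notin> set os" "sorted_wrt (<) os" for os
    proof -
      have "set os \<inter> (M \<union> {x, v}) = {}" using that disj so by auto
      moreover have "\<forall>y\<in>set os. \<forall>w\<in>low S \<union> {x}. w < y" using that lowS so by auto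
      ultimately show ?thesis using satS satH sp that his disj vM by (auto simp: T'_def detS M_def)
    qed
    have low': "low (T' os) \<subseteq> low T" if "set os \<subseteq> set hi" for os using that lowS' by (auto simp: T'_def)
    have rec': "recorded (Q \<union> pset s (det (T' os))) u2" for os
    proof -
      have "det (T' os) = det T \<union> M \<times> {x} \<union> insert x M \<times> {v}" by (auto simp: T'_def detS M_def)
      then show ?thesis using u2(2) by (simp only: pset_Un Un_assoc)
    qed
    have mem': "set (members (T' os)) = M \<union> {x, v} \<union> set os" for os by (auto simp: T'_def M_def)
    have at: "attach r S x hi v u = (if v \<in> set hi then [Done (T' (remove1 v hi)) u2] else [Pend v (T' hi) u2])"
      using u1(1) u2(1) False by (simp add: attach_def T'_def Let_def del: recs.simps)
    have common: "tree_ok s k T Q N (T' os) u2" if "set os \<subseteq> set hi" "v \<notin> set os" "sorted_wrt (<) os" "N = M \<union> {x, v} \<union> set os" for os N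
      proof -
      have "rep (T' os) = rep T" "\<not> leaf (T' os)" "det T \<subseteq> det (T' os)" by (auto simp: T'_def r detS)
      then show ?thesis using sat'[OF that(1-3)] low'[OF that(1)] rec'[of os] mem'[of os] hk2 that(4) by (simp add: tree_ok_def)
    qed
    have dh: "distinct hi" using so by (simp add: strict_sorted_iff)
    show ?thesis
    proof (cases "v \<in> set hi")
      case True
      have "sorted_wrt (<) (remove1 v hi)" using so(2) by (simp add: sorted_remove1 strict_sorted_iff)
      then have "tree_ok s k T Q (set (members T)) (T' (remove1 v hi)) u2"
        by (intro common) (use dh True memT in auto)
      then show ?thesis using at True by (simp add: S_def)
    next
      case F: False
      then have "v \<notin> set (members T)" using memT vM False by auto
      moreover have "tree_ok s k T Q (insert v (set (members T))) (T' hi) u2"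
        by (intro common) (use so F memT in auto)
      ultimately show ?thesis using at F by (simp add: S_def)
    qed
  qed
qed

lemma rep_low: "sat s k T \<Longrightarrow> rep T \<in> low T"
  by (induction T) auto

text \<open>The median of \<open>r\<close> and \<open>x\<close> is the branching vertex
  \<open>c\<close>, so \<open>x\<close> meets all of \<open>l\<close> at \<open>c\<close>. It lies
  strictly below \<open>c\<close>, because \<open>c\<close> is already a member of \<open>t\<close>
  and \<open>x\<close> is still open.\<close>

lemma split_off_ok:
  assumes T: "sat s k (Br r b l t (x # xs))" and dk: "dd (s, r) (s, x) = k" and ev: "b + r + x = k"
    and out: "outside s (set (members (Br r b l t (x # xs)))) Q" and rec: "recorded (Q \<union> pset s (det (Br r b l t (x # xs)))) u"
  shows "\<exists>i\<in>set (split_off r b l t x xs u). item_ok s k (Br r b l t (x # xs)) Q v i"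
proof -
  let ?T = "Br r b l t (x # xs)"
  have l: "sat s k l" and t: "sat s k t" and r: "r = rep l" and so: "sorted_wrt (<) (x # xs)"
    and os: "\<forall>y\<in>set (x # xs). open_ok s k r y \<and> k \<le> b + r + y"
    and disj: "set (members l) \<inter> set (members t) = {}" "set (x # xs) \<inter> (set (members l) \<union> set (members t)) = {}"
    and sp: "split_ok s r b l t" and low: "\<forall>x\<in>set (x # xs). \<forall>y\<in>low l \<union> low_hang t. y < x"
    using T unfolding sat.simps by blast+
  obtain c where c: "b + 2 * c = 153" "c \<in> set (members t)" "\<forall>x\<in>set (members l). z s r x < c \<and> (\<forall>y\<in>set (members t). z s x y = c)"
    "\<forall>y\<in>set (members t). r < y" "leaf t \<longrightarrow> members t = [c]" using sp by (auto simp: split_ok_def)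
  note lm = sat_members[OF l] and tm = sat_members[OF t]
  have rX: "r \<in> X s" "r \<in> set (members l)" using lm r by auto
  have xX: "x \<in> X s" "r < x" using os by (auto simp: open_ok_def)
  have cX: "c \<in> X s" using c tm by auto
  have zrx: "z s r x = c" using dd_same[OF rX(1) xX(1)] dk ev c(1) by simp
  have zmx: "z s m x = c" if "m \<in> set (members l)" for m
    using z_trichotomy[of m s x r] zrx c(3) that lm rX xX by auto
  have zxc: "z s x c = c" using z_absorb[OF xX(1) rX(1)] z_sym[OF rX(1) xX(1)] zrx by simp
  have xl: "x \<notin> set (members l)" "x \<notin> set (members t)" using disj by auto
  have xc: "x < c" using z_ge[OF xX(1) rX(1)] z_sym[OF rX(1) xX(1)] zrx xl c(2) by (metis order.not_eq_order_implies_strict)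
  have "\<exists>u'. recs (members l) (b + x) u = Some u' \<and> recorded ((Q \<union> pset s (det ?T)) \<union> (\<lambda>m. {(s, x), (s, m)}) ` set (members l)) u'"
  proof (rule recs_recorded[OF rec])
    show "distinct (members l)" using lm by simp
    fix m assume m: "m \<in> set (members l)"
    have mX: "m \<in> X s" "m \<noteq> x" using m lm xl by auto
    have "{(s, x), (s, m)} \<in> pairs" using xX mX by (simp add: in_pairs valid_def)
    moreover have "{(s, x), (s, m)} \<notin> Q" using out m by (auto simp: outside_def)
    moreover have "{(s, x), (s, m)} \<notin> pset s (det ?T)" using open_not_det[OF T, of x m] by (simp only: in_pset) simp
    moreover have "dd (s, x) (s, m) = b + x + m" using dd_same[OF xX(1) mX(1)] zmx[OF m] z_sym[OF mX(1) xX(1)] c(1) by simp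
    ultimately show "{(s, x), (s, m)} \<in> pairs - (Q \<union> pset s (det ?T)) \<and> dd (s, x) (s, m) = b + x + m" by simp
  qed
  then obtain u1 where u1: "recs (members l) (b + x) u = Some u1"
    "recorded (Q \<union> pset s (det ?T) \<union> pset s (set (members l) \<times> {x})) u1" by (auto simp only: image_pset)
  have hk: "has k u1"
    using u1(2) rX dk unfolding recorded_def by (metis (no_types, lifting) UnI2 in_pset mem_Sigma_iff singletonI)
  have xs: "\<forall>y\<in>set xs. open_ok s k r y \<and> k \<le> b + r + y" "sorted_wrt (<) xs" "\<forall>y\<in>set xs. x < y" "x \<notin> set xs" using os so by auto
  have main: "tree_ok s k ?T Q (set (members ?T)) (Br r b l t' xs) u'"
    if t': "sat s k t'" "set (members t') = insert x (set (members t))" "low_hang t' \<subseteq> insert x (low_hang t)" "\<not> leaf t'" "det t \<subseteq> det t'"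
      and u': "has k u'" "recorded (Q \<union> pset s (det (Br r b l t' xs))) u'" for t' u'
  proof -
    have "split_ok s r b l t'"
      unfolding split_ok_def by (rule exI[of _ c]) (use c zmx t' xX in auto)
    moreover have "\<forall>y\<in>set xs. \<forall>w\<in>low l \<union> low_hang t'. w < y"
    proof (intro ballI)
      fix y w assume y: "y \<in> set xs" "w \<in> low l \<union> low_hang t'"
      then have "w = x \<or> w \<in> low l \<union> low_hang t" using t'(3) by blast
      then show "w < y" using low y xs by auto
    qed
    moreover have "set (members l) \<inter> set (members t') = {}" "set xs \<inter> (set (members l) \<union> set (members t')) = {}"
      using disj xl xs t' by auto
    ultimately have "sat s k (Br r b l t' xs)" using l t' r xs by simp
    moreover have "low (Br r b l t' xs) \<subseteq> low ?T" using t'(3) unfolding low.simps by auto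
    moreover have "det ?T \<subseteq> det (Br r b l t' xs)" using t'(2,5) by auto
    moreover have "set (members (Br r b l t' xs)) = set (members ?T)" using t'(2) by auto
    ultimately show ?thesis using u' by (simp add: tree_ok_def del: sat.simps det.simps members.simps low.simps)
  qed
  show ?thesis
  proof (cases t)
    case (Lf y ys)
    then have y: "y = c" "ys = []" using c(5) by auto
    let ?t = "Br x b (Lf x []) t []"
    have "\<exists>u'. recs [y] (b + x) u1 = Some u' \<and> recorded ((Q \<union> pset s (det ?T) \<union> pset s (set (members l) \<times> {x})) \<union> (\<lambda>m. {(s, x), (s, m)}) ` set [y]) u'"
    proof (rule recs_recorded[OF u1(2)])
      fix m assume m: "m \<in> set [y]"
      then have m: "m = c" using y by simp
      have ct: "c \<in> set (members t)" by (rule c(2))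
      have "{(s, x), (s, c)} \<in> pairs" using xX cX xc by (simp add: in_pairs valid_def)
      moreover have "{(s, x), (s, c)} \<notin> Q" using out ct by (auto simp: outside_def)
      moreover have "{(s, x), (s, c)} \<notin> pset s (det ?T)" using open_not_det[OF T, of x c] by (simp only: in_pset) simp
      moreover have "{(s, x), (s, c)} \<notin> pset s (set (members l) \<times> {x})" using ct disj xl by (auto simp: in_pset)
      moreover have "dd (s, x) (s, c) = b + x + c" using dd_same[OF xX(1) cX] zxc c(1) by simp
      ultimately show "{(s, x), (s, m)} \<in> pairs - (Q \<union> pset s (det ?T) \<union> pset s (set (members l) \<times> {x})) \<and> dd (s, x) (s, m) = b + x + m"
        using m by simp
    qed simp
    then obtain u2 where u2: "recs [y] (b + x) u1 = Some u2"
      "recorded (Q \<union> pset s (det ?T) \<union> pset s (set (members l) \<times> {x}) \<union> (\<lambda>m. {(s, x), (s, m)}) ` set [y]) u2" by blast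
    have eq: "Q \<union> pset s (det ?T) \<union> pset s (set (members l) \<times> {x}) \<union> (\<lambda>m. {(s, x), (s, m)}) ` set [y] = Q \<union> pset s (det (Br r b l ?t xs))"
      unfolding image_pset by (auto simp: Lf y in_pset pset_def)
    have "split_ok s x b (Lf x []) t"
      unfolding split_ok_def by (rule exI[of _ c]) (use c zxc xc xX z_same Lf y in auto)
    then have "sat s k ?t" using xX t xc Lf y by simp
    then have "tree_ok s k ?T Q (set (members ?T)) (Br r b l ?t xs) u2"
    proof (rule main)
      show "has k u2" using has_mono[OF hk u1(2) u2(2)] .
      show "recorded (Q \<union> pset s (det (Br r b l ?t xs))) u2" using u2(2) unfolding eq .
    qed (use Lf in auto)
    moreover have "split_off r b l t x xs u = [Done (Br r b l ?t xs) u2]"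
      using u1(1) u2(1) Lf by (simp add: split_off_def)
    ultimately show ?thesis by simp
  next
    case (Br r2 b2 l2 t2 os2)
    have rt: "rep t \<in> X s" "rep t \<in> set (members t)" "r < rep t" using tm c(4) by auto
    have rtl: "rep t \<in> low t" using rep_low[OF t] .
    \<comment> \<open>A hanging tree that is not a leaf is subject to the order of
      discovery.\<close>
    have rtx: "rep t < x" using rtl low Br by auto
    have zrt: "z s (rep t) x \<le> c" using ultra[OF rt(1) xX(1) rX(1)] zrx c(3) rX rt z_sym by (metis max.idem)
    have "sat s k (put x t)"
    proof (rule sat_put[OF t])
      show "open_ok s k (rep t) x" using xX rtx dd_same[OF rt(1) xX(1)] zrt rt(3) ev c(1) by (simp add: open_ok_def)
      show "x \<notin> set (members t)" by (rule xl)
      show "\<forall>y\<in>low t. y < x" using low Br by auto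
      fix r3 b3 l3 t3 os3 assume eq: "t = Br r3 b3 l3 t3 os3"
      then obtain c3 where c3: "b3 + 2 * c3 = 153" "c3 \<in> set (members t3)" "\<forall>x\<in>set (members l3). \<forall>y\<in>set (members t3). z s x y = c3"
        using t by (auto simp: split_ok_def)
      have r3: "r3 = rep t" "r3 \<in> set (members l3)" using t eq sat_members[of s k l3] by auto
      have c3t: "c3 \<in> set (members t)" "c3 \<in> X s" using eq c3 tm by auto
      \<comment> \<open>By the ultrametric inequality through \<open>r\<close>, a branching vertex
        inside \<open>t\<close> is at most as high as \<open>c\<close>. As the least height of
        \<open>t\<close> exceeds \<open>r\<close>, the height \<open>x\<close> is not overdue in
        \<open>t\<close>.\<close>
      have "z s r3 c3 \<le> max (z s r3 r) (z s r c3)" using ultra rt r3 c3t rX by metis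
      then have "c3 \<le> c" using c3 r3 c(3) rX c3t rt z_sym by (metis max.idem)
      then show "k \<le> b3 + r3 + x" using c3(1) c(1) ev rt(3) r3 by simp
    qed
    then have "tree_ok s k ?T Q (set (members ?T)) (Br r b l (put x t) xs) u1"
    proof (rule main)
      have "Q \<union> pset s (det (Br r b l (put x t) xs)) = Q \<union> pset s (det ?T) \<union> pset s (set (members l) \<times> {x})"
        by (auto simp: pset_def)
      then show "recorded (Q \<union> pset s (det (Br r b l (put x t) xs))) u1" using u1(2) by simp
    qed (use Br hk in auto)
    moreover have "split_off r b l t x xs u = [Done (Br r b l (put x t) xs) u1]"
      using u1(1) Br by (simp add: split_off_def)
    ultimately show ?thesis by simp
  qed
qed

lemma attach_all_set:
  assumes "even (q + x)"
  shows "set (attach r (with_open (lo @ ps) S) x hi ((q + x) div 2) u) \<subseteq> set (attach_all (ps @ x # hi) lo S r q u)"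
proof (induction ps arbitrary: lo)
  case Nil
  then show ?case using assms by simp
next
  case (Cons p ps)
  show ?case using Cons.IH[of "lo @ [p]"] unfolding append_Cons attach_all.simps set_append append_assoc append_Nil by blast
qed

lemma with_open_with_open [simp]: "with_open os (with_open os' T) = with_open os T"
  by (cases T) auto

lemma attach_all_ok:
  assumes T: "sat s k T" and op: "opens T = lo @ ps @ x # hi" and r: "r = rep T" and dk: "dd (s, r) (s, x) = k"
    and ev: "\<And>r b l t os. T = Br r b l t os \<Longrightarrow> k < b + r + x"
    and out: "outside s (set (members T)) Q" and rec: "recorded (Q \<union> pset s (det T)) u"
    and v: "v = z s r x" and new: "v \<notin> set (members T) \<Longrightarrow> \<forall>m\<in>set (members T). {(s, v), (s, m)} \<notin> Q"
    and q: "q + k = 153 + r"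
  shows "\<exists>i\<in>set (attach_all (ps @ x # hi) lo (with_open [] T) r q u). item_ok s k T Q v i"
proof -
  have "x \<in> X s" "r \<in> X s" using sat_members[OF T] opens_members[of T] op r by auto
  then have e: "q + x = 2 * v" using dd_same[of r s x] dk v q by simp
  have "\<exists>i\<in>set (attach r (with_open (lo @ ps) T) x hi v u). item_ok s k T Q v i"
    by (rule attach_ok[OF T _ r dk _ out rec v new]) (use op ev in auto)
  moreover have "set (attach r (with_open (lo @ ps) T) x hi v u) \<subseteq> set (attach_all (ps @ x # hi) lo (with_open [] T) r q u)"
    using attach_all_set[of q x r lo ps "with_open [] T" hi u] e by simp
  ultimately show ?thesis by blast
qed

text \<open>By the ultrametric inequality through \<open>r\<close>, two vertices of \<open>l\<close>
  meet below the branching vertex \<open>c\<close>. If their median is new to \<open>l\<close>, it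
  meets all of \<open>t\<close> at \<open>c\<close>, so the deficits entered by
  \<open>raise_left\<close> are the true ones.\<close>

lemma item_ok_Br_left:
  assumes T: "sat s k (Br r b l t os)" and out: "outside s (set (members (Br r b l t os))) Q"
    and rec: "recorded (Q \<union> pset s (det (Br r b l t os))) u"
    and xy: "x \<in> set (members l)" "y \<in> set (members l)" and v: "v = z s x y" and xy': "x \<noteq> y"
    and new: "v \<notin> set (members (Br r b l t os)) \<Longrightarrow> \<forall>m\<in>set (members (Br r b l t os)). {(s, v), (s, m)} \<notin> Q"
    and IH: "\<And>Q. \<lbrakk>outside s (set (members l)) Q; recorded (Q \<union> pset s (det l)) u;
        v \<notin> set (members l) \<Longrightarrow> \<forall>m\<in>set (members l). {(s, v), (s, m)} \<notin> Q\<rbrakk> \<Longrightarrow> \<exists>i\<in>set (items l k K u). item_ok s k l Q v i"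
  shows "\<exists>i\<in>set (items l k K u). \<exists>j\<in>set (raise_left r b t os i). item_ok s k (Br r b l t os) Q v j"
proof -
  let ?T = "Br r b l t os" and ?L = "set (members l)" and ?M = "set (members t)"
  have l: "sat s k l" and t: "sat s k t" and r: "r = rep l" and so: "sorted_wrt (<) os"
    and os: "\<forall>y\<in>set os. open_ok s k r y \<and> k \<le> b + r + y"
    and disj: "?L \<inter> ?M = {}" "set os \<inter> (?L \<union> ?M) = {}"
    and sp: "split_ok s r b l t" and low: "\<forall>x\<in>set os. \<forall>y\<in>low l \<union> low_hang t. y < x"
    using T unfolding sat.simps by blast+
  obtain c where c: "b + 2 * c = 153" "c \<in> ?M" "\<forall>x\<in>?L. z s r x < c \<and> (\<forall>y\<in>?M. z s x y = c)"
    "\<forall>y\<in>?M. r < y" "leaf t \<longrightarrow> members t = [c]" using sp by (auto simp: split_ok_def)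
  note lm = sat_members[OF l] and tm = sat_members[OF t]
  have rX: "r \<in> X s" "r \<in> ?L" using lm r by auto
  have X: "x \<in> X s" "y \<in> X s" "v \<in> X s" using xy lm v z_in by auto
  have xv: "z s x v = v" using z_absorb X v by simp
  have "v \<le> max (z s x r) (z s r y)" using ultra X rX v by simp
  then have vc: "v < c" using c(3) xy z_sym[OF X(1) rX(1)] by (metis max_less_iff_conj order_le_less_trans)
  have vM: "v \<notin> ?M" using c(3) xy xv vc by auto
  have "z s r v \<le> max (z s r x) (z s x v)" using ultra X rX by simp
  then have zrv: "z s r v < c" using c(3) xy xv vc by (metis max_less_iff_conj order_le_less_trans)
  have zvm: "z s v m = c" if "m \<in> ?M" for m
    using z_trichotomy[of v s m r] zrv c(3) that tm X rX by auto
  define Ql where "Ql = Q \<union> pset s (?L \<times> ?M) \<union> pset s (det t)"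
  have e1: "Q \<union> pset s (det ?T) = Ql \<union> pset s (det l)"
    by (simp add: Ql_def pset_Un Un_ac)
  have newQ: "{(s, v), (s, m)} \<notin> Q" if "v \<notin> ?L" "m \<in> set (members ?T)" for m
  proof (cases "v \<in> set (members ?T)")
    case True
    then show ?thesis using out that by (auto simp: outside_def)
  qed (use new that in auto)
  have "\<exists>i\<in>set (items l k K u). item_ok s k l Ql v i"
  proof (rule IH)
    show "outside s ?L Ql"
      unfolding Ql_def outside_Un outside_pset using out disj det_members[of _ _ t]
      by (auto simp: outside_def)
    show "recorded (Ql \<union> pset s (det l)) u" using rec e1 by simp
    assume a: "v \<notin> ?L"
    show "\<forall>m\<in>?L. {(s, v), (s, m)} \<notin> Ql"
      using newQ[OF a] a vM disj by (auto simp: Ql_def in_pset dest: det_members)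
  qed
  then obtain i where i: "i \<in> set (items l k K u)" "item_ok s k l Ql v i" by blast
  have raise: "tree_ok s k ?T Q N (Br r b l' t os') u'"
    if l': "sat s k l'" "rep l' = rep l" "low l' \<subseteq> low l" "set (members l') = ?L \<or> set (members l') = insert v ?L" "det l \<subseteq> det l'"
      and u': "has k u'" "recorded (Q \<union> pset s (det (Br r b l' t os'))) u'"
      and os': "set os' \<subseteq> set os" "sorted_wrt (<) os'" "set os' \<inter> set (members l') = {}" and N: "N = set (members l') \<union> ?M \<union> set os'"
    for l' os' u' N
  proof -
    have "split_ok s r b l' t"
      unfolding split_ok_def by (rule exI[of _ c]) (use c l'(4) zrv zvm in auto)
    moreover have "\<forall>y\<in>set os'. \<forall>w\<in>low l' \<union> low_hang t. w < y" using low l'(3) os'(1) by blast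
    moreover have "set (members l') \<inter> ?M = {}" "set os' \<inter> (set (members l') \<union> ?M) = {}"
      using disj l'(4) os' vM by auto
    moreover have "\<forall>y\<in>set os'. open_ok s k r y \<and> k \<le> b + r + y" using os os' by auto
    ultimately have "sat s k (Br r b l' t os')" using l' t r os' by simp
    moreover have "low (Br r b l' t os') \<subseteq> low ?T" using l'(3) os'(1) unfolding low.simps by auto
    moreover have "det ?T \<subseteq> det (Br r b l' t os')" using l'(4,5) by auto
    moreover have "set (members (Br r b l' t os')) = N" using N by auto
    ultimately show ?thesis using u' by (simp add: tree_ok_def del: sat.simps det.simps members.simps low.simps)
  qed
  show ?thesis
  proof (cases i)
    case (Done l' u')
    then have l': "tree_ok s k l Ql ?L l' u'" using i by simp
    have e: "Ql \<union> pset s (det l') = Q \<union> pset s (det (Br r b l' t os))"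
      using l' by (simp add: Ql_def pset_Un Un_ac tree_ok_def)
    have "tree_ok s k ?T Q (set (members ?T)) (Br r b l' t os) u'"
      by (rule raise) (use l' so disj e in \<open>auto simp: tree_ok_def\<close>)
    then have "\<exists>j\<in>set (raise_left r b t os i). item_ok s k ?T Q v j" using Done by simp
    then show ?thesis using i(1) by blast
  next
    case (Pend w l' u1)
    then have w: "w = v" and vL: "v \<notin> ?L" and l': "tree_ok s k l Ql (insert v ?L) l' u1" using i by auto
    have "\<exists>u'. recs (members t) (b + v) u1 = Some u' \<and> recorded ((Ql \<union> pset s (det l')) \<union> (\<lambda>m. {(s, v), (s, m)}) ` ?M) u'"
    proof (rule recs_recorded)
      show "recorded (Ql \<union> pset s (det l')) u1" using l' by (simp add: tree_ok_def)
      show "distinct (members t)" using tm by simp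
      fix m assume m: "m \<in> ?M"
      have mX: "m \<in> X s" "m \<noteq> v" "m \<notin> ?L" using m tm vM disj by auto
      have "{(s, v), (s, m)} \<in> pairs" using X mX by (simp add: in_pairs valid_def)
      moreover have "{(s, v), (s, m)} \<notin> Ql" using newQ[OF vL] m vL vM mX by (auto simp: Ql_def in_pset dest: det_members)
      moreover have "{(s, v), (s, m)} \<notin> pset s (det l')" using l' mX det_members[of _ _ l'] by (auto simp: in_pset tree_ok_def)
      moreover have "dd (s, v) (s, m) = b + v + m" using dd_same[OF X(3) mX(1)] zvm[OF m] c(1) by simp
      ultimately show "{(s, v), (s, m)} \<in> pairs - (Ql \<union> pset s (det l')) \<and> dd (s, v) (s, m) = b + v + m" by simp
    qed
    then obtain u' where u': "recs (members t) (b + v) u1 = Some u'"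
      "recorded (Ql \<union> pset s (det l') \<union> pset s (?M \<times> {v})) u'" by (auto simp only: image_pset)
    have hk: "has k u'" using has_mono[of k u1 "Ql \<union> pset s (det l')"] l' u'(2) by (auto simp: tree_ok_def)
    have sw: "pset s (?M \<times> {v}) = pset s ({v} \<times> ?M)" by (auto simp: pset_def)
    have e: "Ql \<union> pset s (det l') \<union> pset s (?M \<times> {v}) = Q \<union> pset s (det (Br r b l' t os'))" for os'
    proof -
      have "det (Br r b l' t os') = ?L \<times> ?M \<union> {v} \<times> ?M \<union> det l' \<union> det t" using l' by (auto simp: tree_ok_def)
      then show ?thesis by (simp only: Ql_def sw pset_Un Un_ac)
    qed
    have dos: "distinct os" using so by (simp add: strict_sorted_iff)
    show ?thesis
    proof (cases "v \<in> set os")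
      case True
      have "tree_ok s k ?T Q (set (members ?T)) (Br r b l' t (remove1 v os)) u'"
      proof (rule raise)
        show "recorded (Q \<union> pset s (det (Br r b l' t (remove1 v os)))) u'" using u'(2) e by simp
        show "sorted_wrt (<) (remove1 v os)" using so by (simp add: sorted_remove1 strict_sorted_iff)
      qed (use l' dos True disj hk in \<open>auto simp: tree_ok_def\<close>)
      then have "\<exists>j\<in>set (raise_left r b t os i). item_ok s k ?T Q v j" using Pend w u'(1) True by simp
      then show ?thesis using i(1) by blast
    next
      case False
      have "tree_ok s k ?T Q (insert v (set (members ?T))) (Br r b l' t os) u'"
      proof (rule raise)
        show "recorded (Q \<union> pset s (det (Br r b l' t os))) u'" using u'(2) e by simp
      qed (use l' so False disj hk in \<open>auto simp: tree_ok_def\<close>)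
      then have "\<exists>j\<in>set (raise_left r b t os i). item_ok s k ?T Q v j" using Pend w u'(1) False vL vM by simp
      then show ?thesis using i(1) by blast
    qed
  qed
qed

text \<open>Two vertices of \<open>t\<close> meet no higher than \<open>c\<close>, and
  \<open>c\<close> itself is in \<open>t\<close>. A median outside \<open>t\<close> is therefore
  strictly below \<open>c\<close> and meets all of \<open>l\<close> at \<open>c\<close>.\<close>

lemma item_ok_Br_right:
  assumes T: "sat s k (Br r b l t os)" and out: "outside s (set (members (Br r b l t os))) Q"
    and rec: "recorded (Q \<union> pset s (det (Br r b l t os))) u"
    and xy: "x \<in> set (members t)" "y \<in> set (members t)" and v: "v = z s x y" and xy': "x \<noteq> y"
    and new: "v \<notin> set (members (Br r b l t os)) \<Longrightarrow> \<forall>m\<in>set (members (Br r b l t os)). {(s, v), (s, m)} \<notin> Q"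
    and IH: "\<And>Q. \<lbrakk>outside s (set (members t)) Q; recorded (Q \<union> pset s (det t)) u;
        v \<notin> set (members t) \<Longrightarrow> \<forall>m\<in>set (members t). {(s, v), (s, m)} \<notin> Q\<rbrakk> \<Longrightarrow> \<exists>i\<in>set (items t k K u). item_ok s k t Q v i"
  shows "\<exists>i\<in>set (items t k K u). \<exists>j\<in>set (raise_right r b l os i). item_ok s k (Br r b l t os) Q v j"
proof -
  let ?T = "Br r b l t os" and ?L = "set (members l)" and ?M = "set (members t)"
  have l: "sat s k l" and t: "sat s k t" and r: "r = rep l" and so: "sorted_wrt (<) os"
    and os: "\<forall>y\<in>set os. open_ok s k r y \<and> k \<le> b + r + y"
    and disj: "?L \<inter> ?M = {}" "set os \<inter> (?L \<union> ?M) = {}"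
    and sp: "split_ok s r b l t" and low: "\<forall>x\<in>set os. \<forall>y\<in>low l \<union> low_hang t. y < x"
    using T unfolding sat.simps by blast+
  obtain c where c: "b + 2 * c = 153" "c \<in> ?M" "\<forall>x\<in>?L. z s r x < c \<and> (\<forall>y\<in>?M. z s x y = c)"
    "\<forall>y\<in>?M. r < y" "leaf t \<longrightarrow> members t = [c]" using sp by (auto simp: split_ok_def)
  \<comment> \<open>A hanging leaf has a single member. With the leaf excluded, \<open>low t\<close>
    is not exempt and bounds the heights of the modified tree.\<close>
  have nl: "\<not> leaf t" using c(5) xy xy' by auto
  note lm = sat_members[OF l] and tm = sat_members[OF t]
  have rX: "r \<in> X s" "r \<in> ?L" using lm r by auto
  have X: "x \<in> X s" "y \<in> X s" "v \<in> X s" using xy tm v z_in by auto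
  have xv: "z s x v = v" using z_absorb X v by simp
  have vge: "x \<le> v" using z_ge X v by simp
  then have rv: "r < v" using c(4) xy by auto
  have zmc: "z s x m = c" if "m \<in> ?L" for m using c(3) xy that lm X z_sym by auto
  have "v \<le> max (z s x r) (z s r y)" using ultra X rX v by simp
  then have vc: "v \<le> c" using c(3) zmc rX xy by auto
  have small: "v < c" if "v \<notin> ?M" using vc c(2) that by (metis le_neq_implies_less)
  have vL: "v \<notin> ?L" if "v \<notin> ?M" using zmc[of v] xv small[OF that] by auto
  have zmv: "z s m v = c" if "m \<in> ?L" "v \<notin> ?M" for m
  proof -
    have "z s v m = z s x m"
      by (rule z_trichotomy[of v s m x]) (use xv small that zmc lm X in auto)
    then show ?thesis using zmc that z_sym[of m s v] lm X by auto
  qed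
  define Qt where "Qt = Q \<union> pset s (?L \<times> ?M) \<union> pset s (det l)"
  have e1: "Q \<union> pset s (det ?T) = Qt \<union> pset s (det t)"
    by (simp add: Qt_def pset_Un Un_ac)
  have newQ: "{(s, v), (s, m)} \<notin> Q" if "v \<notin> ?M" "m \<in> set (members ?T)" for m
  proof (cases "v \<in> set (members ?T)")
    case True
    then show ?thesis using out that by (auto simp: outside_def)
  qed (use new that in auto)
  have "\<exists>i\<in>set (items t k K u). item_ok s k t Qt v i"
  proof (rule IH)
    show "outside s ?M Qt"
      unfolding Qt_def outside_Un outside_pset using out disj det_members[of _ _ l]
      by (auto simp: outside_def) blast
    show "recorded (Qt \<union> pset s (det t)) u" using rec e1 by simp
    assume a: "v \<notin> ?M"
    show "\<forall>m\<in>?M. {(s, v), (s, m)} \<notin> Qt"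
      using newQ[OF a] a vL disj by (auto simp: Qt_def in_pset dest: det_members)
  qed
  then obtain i where i: "i \<in> set (items t k K u)" "item_ok s k t Qt v i" by blast
  have raise: "tree_ok s k ?T Q N (Br r b l t' os') u'"
    if t': "sat s k t'" "low t' \<subseteq> low t" "\<not> leaf t'" "set (members t') = ?M \<or> v \<notin> ?M \<and> set (members t') = insert v ?M" "det t \<subseteq> det t'"
      and u': "has k u'" "recorded (Q \<union> pset s (det (Br r b l t' os'))) u'"
      and os': "set os' \<subseteq> set os" "sorted_wrt (<) os'" "set os' \<inter> set (members t') = {}" and N: "N = ?L \<union> set (members t') \<union> set os'"
    for t' os' u' N
  proof -
    have "split_ok s r b l t'"
      unfolding split_ok_def by (rule exI[of _ c]) (use c t'(3,4) zmv rv in auto)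
    moreover have "\<forall>y\<in>set os'. \<forall>w\<in>low l \<union> low_hang t'. w < y" using low nl t' os'(1) by (simp, blast)
    moreover have "?L \<inter> set (members t') = {}" "set os' \<inter> (?L \<union> set (members t')) = {}"
      using disj t'(4) os' vL by auto
    moreover have "\<forall>y\<in>set os'. open_ok s k r y \<and> k \<le> b + r + y" using os os' by auto
    ultimately have "sat s k (Br r b l t' os')" using l t' r os' by simp
    moreover have "low (Br r b l t' os') \<subseteq> low ?T" using t'(2) nl os'(1) unfolding low.simps by auto
    moreover have "det ?T \<subseteq> det (Br r b l t' os')" using t'(4,5) by auto
    moreover have "set (members (Br r b l t' os')) = N" using N by auto
    ultimately show ?thesis using u' by (simp add: tree_ok_def del: sat.simps det.simps members.simps low.simps)
  qed
  show ?thesis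
  proof (cases i)
    case (Done t' u')
    then have t': "tree_ok s k t Qt ?M t' u'" using i by simp
    have e: "Qt \<union> pset s (det t') = Q \<union> pset s (det (Br r b l t' os))"
      using t' by (simp add: Qt_def pset_Un Un_ac tree_ok_def)
    have "tree_ok s k ?T Q (set (members ?T)) (Br r b l t' os) u'"
      by (rule raise) (use t' so disj e in \<open>auto simp: tree_ok_def\<close>)
    then have "\<exists>j\<in>set (raise_right r b l os i). item_ok s k ?T Q v j" using Done by simp
    then show ?thesis using i(1) by blast
  next
    case (Pend w t' u1)
    then have w: "w = v" and vM: "v \<notin> ?M" and t': "tree_ok s k t Qt (insert v ?M) t' u1" using i by auto
    have "\<exists>u'. recs (members l) (b + v) u1 = Some u' \<and> recorded ((Qt \<union> pset s (det t')) \<union> (\<lambda>m. {(s, v), (s, m)}) ` ?L) u'"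
    proof (rule recs_recorded)
      show "recorded (Qt \<union> pset s (det t')) u1" using t' by (simp add: tree_ok_def)
      show "distinct (members l)" using lm by simp
      fix m assume m: "m \<in> ?L"
      have mX: "m \<in> X s" "m \<noteq> v" "m \<notin> ?M" using m lm vL[OF vM] disj by auto
      have "{(s, v), (s, m)} \<in> pairs" using X mX by (simp add: in_pairs valid_def)
      moreover have "{(s, v), (s, m)} \<notin> Qt" using newQ[OF vM] m vL[OF vM] vM mX by (auto simp: Qt_def in_pset dest: det_members)
      moreover have "{(s, v), (s, m)} \<notin> pset s (det t')" using t' mX det_members[of _ _ t'] by (auto simp: in_pset tree_ok_def)
      moreover have "dd (s, v) (s, m) = b + v + m" using dd_same[OF X(3) mX(1)] zmv[OF m vM] z_sym[OF X(3) mX(1)] c(1) by simp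
      ultimately show "{(s, v), (s, m)} \<in> pairs - (Qt \<union> pset s (det t')) \<and> dd (s, v) (s, m) = b + v + m" by simp
    qed
    then obtain u' where u': "recs (members l) (b + v) u1 = Some u'"
      "recorded (Qt \<union> pset s (det t') \<union> pset s (?L \<times> {v})) u'" by (auto simp only: image_pset)
    have hk: "has k u'" using has_mono[of k u1 "Qt \<union> pset s (det t')"] t' u'(2) by (auto simp: tree_ok_def)
    have e: "Qt \<union> pset s (det t') \<union> pset s (?L \<times> {v}) = Q \<union> pset s (det (Br r b l t' os'))" for os'
    proof -
      have "det (Br r b l t' os') = ?L \<times> ?M \<union> ?L \<times> {v} \<union> det t' \<union> det l" using t' by (auto simp: tree_ok_def)
      then show ?thesis by (simp only: Qt_def pset_Un Un_ac)
    qed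
    have dos: "distinct os" using so by (simp add: strict_sorted_iff)
    show ?thesis
    proof (cases "v \<in> set os")
      case True
      have "tree_ok s k ?T Q (set (members ?T)) (Br r b l t' (remove1 v os)) u'"
      proof (rule raise)
        show "recorded (Q \<union> pset s (det (Br r b l t' (remove1 v os)))) u'" using u'(2) e by simp
        show "sorted_wrt (<) (remove1 v os)" using so by (simp add: sorted_remove1 strict_sorted_iff)
      qed (use t' dos True disj hk vM in \<open>auto simp: tree_ok_def\<close>)
      then have "\<exists>j\<in>set (raise_right r b l os i). item_ok s k ?T Q v j" using Pend w u'(1) True by simp
      then show ?thesis using i(1) by blast
    next
      case False
      have "tree_ok s k ?T Q (insert v (set (members ?T))) (Br r b l t' os) u'"
      proof (rule raise)
        show "recorded (Q \<union> pset s (det (Br r b l t' os))) u'" using u'(2) e by simp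
      qed (use t' so False disj hk vM in \<open>auto simp: tree_ok_def\<close>)
      then have "\<exists>j\<in>set (raise_right r b l os i). item_ok s k ?T Q v j" using Pend w u'(1) False vL vM by simp
      then show ?thesis using i(1) by blast
    qed
  qed
qed

lemma set_maps: "set (maps f xs) = (\<Union>x\<in>set xs. set (f x))"
  by (induction xs) auto

lemma items_ok:
  assumes "sat s k T" "outside s (set (members T)) Q" "recorded (Q \<union> pset s (det T)) u"
    and "x \<in> set (members T)" "y \<in> set (members T)" "x \<noteq> y" "dd (s, x) (s, y) = k" "\<not> has k u" "v = z s x y"
    and "v \<notin> set (members T) \<Longrightarrow> \<forall>m\<in>set (members T). {(s, v), (s, m)} \<notin> Q" and K: "K + k = 153"
  shows "\<exists>i\<in>set (items T k K u). item_ok s k T Q v i"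
  using assms(1-10)
proof (induction T arbitrary: Q x y)
  case (Lf r os)
  let ?T = "Lf r os"
  have r: "r \<in> X s" using Lf.prems by simp
  \<comment> \<open>Two open heights meet no higher than the higher of their medians with
    \<open>r\<close>; since both exceed \<open>r\<close>, their deficit is larger than
    \<open>k\<close>.\<close>
  have "\<exists>w\<in>set os. {x, y} = {r, w}"
  proof (rule ccontr)
    assume "\<not> ?thesis"
    then have a: "x \<in> set os" "y \<in> set os" using Lf.prems by auto
    then have o: "open_ok s k r x" "open_ok s k r y" using Lf.prems by auto
    then have X: "x \<in> X s" "y \<in> X s" "r < x" "r < y" by (auto simp: open_ok_def)
    have "z s x y \<le> max (z s r x) (z s r y)" using ultra[of x s y r] X r z_sym[of x s r] by simp
    then show False using dd_same[OF X(1,2)] dd_same[OF r X(1)] dd_same[OF r X(2)] o X Lf.prems(7)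
      by (auto simp: open_ok_def max_def split: if_splits)
  qed
  then obtain w where w: "w \<in> set os" "{x, y} = {r, w}" by blast
  then have v: "v = z s r w" "dd (s, r) (s, w) = k"
    using Lf.prems z_sym[of x s y] dd_sym[of "(s, x)" "(s, y)"] by (auto simp: doubleton_eq_iff valid_def open_ok_def)
  obtain ps hi where ps: "os = ps @ w # hi" using w by (metis split_list)
  have "\<exists>i\<in>set (attach_all (ps @ w # hi) [] (with_open [] ?T) r (K + r) u). item_ok s k ?T Q v i"
    by (rule attach_all_ok[OF Lf.prems(1) _ _ v(2) _ Lf.prems(2,3) v(1) Lf.prems(10)]) (use ps K in auto)
  then show ?case using ps by simp
next
  case (Br r b l t os)
  let ?T = "Br r b l t os" and ?L = "set (members l)" and ?M = "set (members t)"
  have l: "sat s k l" and t: "sat s k t" and r: "r = rep l" and so: "sorted_wrt (<) os"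
    and osk: "\<forall>y\<in>set os. open_ok s k r y \<and> k \<le> b + r + y"
    and disj: "?L \<inter> ?M = {}" "set os \<inter> (?L \<union> ?M) = {}"
    and sp: "split_ok s r b l t" and low: "\<forall>x\<in>set os. \<forall>y\<in>low l \<union> low_hang t. y < x"
    using Br.prems(1) unfolding sat.simps by blast+
  obtain c where c: "b + 2 * c = 153" "c \<in> ?M" "\<forall>x\<in>?L. z s r x < c \<and> (\<forall>y\<in>?M. z s x y = c)"
    "\<forall>y\<in>?M. r < y" using sp by (auto simp: split_ok_def)
  note lm = sat_members[OF l] and tm = sat_members[OF t]
  have rX: "r \<in> X s" "r \<in> ?L" using lm r by auto
  have TX: "set (members ?T) \<subseteq> X s" using sat_members[OF Br.prems(1)] by blast
  have X: "x \<in> X s" "y \<in> X s" using TX Br.prems(4,5) by auto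
  have kyx: "dd (s, y) (s, x) = k" using dd_sym[of "(s, x)" "(s, y)"] X Br.prems(7) by (simp add: valid_def)
  have nd: "(x, y) \<notin> det ?T" "(y, x) \<notin> det ?T"
  proof -
    have "{(s, x), (s, y)} \<notin> Q \<union> pset s (det ?T)"
      using Br.prems(3,7,8) unfolding recorded_def by blast
    then show "(x, y) \<notin> det ?T" "(y, x) \<notin> det ?T" by (auto simp only: in_pset Un_iff)
  qed
  consider (l) "x \<in> ?L" "y \<in> ?L" | (t) "x \<in> ?M" "y \<in> ?M" | (os) "x \<in> set os \<or> y \<in> set os"
    using Br.prems(4,5) nd by auto
  then show ?case
  proof cases
    case l
    have "\<exists>i\<in>set (items l k K u). \<exists>j\<in>set (raise_left r b t os i). item_ok s k ?T Q v j"
      by (rule item_ok_Br_left[OF Br.prems(1-3) l Br.prems(9,6,10)])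
        (use Br.IH(1)[OF \<open>sat s k l\<close> _ _ l Br.prems(6-9)] in blast)+
    then show ?thesis by (auto simp: set_maps)
  next
    case t
    have "\<exists>i\<in>set (items t k K u). \<exists>j\<in>set (raise_right r b l os i). item_ok s k ?T Q v j"
      by (rule item_ok_Br_right[OF Br.prems(1-3) t Br.prems(9,6,10)])
        (use Br.IH(2)[OF \<open>sat s k t\<close> _ _ t Br.prems(6-9)] in blast)+
    then show ?thesis by (auto simp: set_maps)
  next
    case os
    \<comment> \<open>The median of \<open>w\<close> and \<open>m\<close> is bounded by their
      medians with \<open>r\<close>, which in turn are bounded by openness or by \<open>c\<close>.
      As \<open>w\<close> and \<open>m\<close> both exceed \<open>r\<close>, the deficit exceeds
      \<open>k\<close>.\<close>
    have far: "k < dd (s, w) (s, m)" if "w \<in> set os" "m \<in> set (members ?T)" "m \<noteq> r" "m \<noteq> w" for w m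
    proof -
      have w: "open_ok s k r w" "k \<le> b + r + w" "w \<in> X s" "r < w" using osk that by (auto simp: open_ok_def)
      have m: "m \<in> X s" "r < m"
        using TX that sat_members[OF Br.prems(1)] by (auto simp: order.order_iff_strict)
      have zw: "2 * z s r w + k \<le> 153 + r + w" using dd_same[OF rX(1) w(3)] w(1) by (simp add: open_ok_def)
      have zwm: "z s w m \<le> max (z s r w) (z s r m)" using ultra[of w s m r] w m rX z_sym[of w s r] by simp
      show ?thesis
      proof (cases "m \<in> set os")
        case True
        then have "k \<le> dd (s, r) (s, m)" using osk by (simp add: open_ok_def)
        then have "2 * z s r m + k \<le> 153 + r + m" using dd_same[OF rX(1) m(1)] by simp
        then show ?thesis using dd_same[OF w(3) m(1)] zw zwm w m by (auto simp: max_def split: if_splits)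
      next
        case False
        then have "z s r m \<le> c" using that c(3) rX by fastforce
        then show ?thesis using dd_same[OF w(3) m(1)] zw zwm w m c(1) by (auto simp: max_def split: if_splits)
      qed
    qed
    have "\<exists>w\<in>set os. {x, y} = {r, w}"
    proof (cases "x \<in> set os")
      case True
      then show ?thesis using far[of x y] Br.prems(5-7) by (metis insert_commute less_irrefl)
    next
      case False
      then show ?thesis using os far[of y x] Br.prems(4,6) kyx by (metis less_irrefl)
    qed
    then obtain w where w: "w \<in> set os" "{x, y} = {r, w}" by blast
    have v: "v = z s r w" "dd (s, r) (s, w) = k"
      using w Br.prems(7,9) kyx z_sym[OF X] by (auto simp: doubleton_eq_iff)
    obtain o1 os1 where o1: "os = o1 # os1" using w by (cases os) auto
    have ev: "k \<le> b + r + w" using osk w by auto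
    show ?thesis
    proof (cases "b + r + o1 = k")
      case True
      show ?thesis
      proof (cases "w = o1")
        case True
        then have "\<exists>i\<in>set (split_off r b l t o1 os1 u). item_ok s k ?T Q v i"
          using split_off_ok[OF Br.prems(1)[unfolded o1] _ _ Br.prems(2,3)[unfolded o1]] v(2) \<open>b + r + o1 = k\<close>
          unfolding o1 by blast
        then show ?thesis using o1 \<open>b + r + o1 = k\<close> by (auto simp: top_items_def)
      next
        case False
        then obtain ps hi where ps: "os1 = ps @ w # hi" using w o1 by (auto dest: split_list)
        have "o1 < w" using so o1 ps by auto
        have "\<exists>i\<in>set (attach_all (ps @ w # hi) [o1] (with_open [] ?T) r (K + r) u). item_ok s k ?T Q v i"
          by (rule attach_all_ok[OF Br.prems(1) _ _ v(2) _ Br.prems(2,3) v(1) Br.prems(10)])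
            (use ps K o1 \<open>o1 < w\<close> \<open>b + r + o1 = k\<close> in auto)
        then show ?thesis using o1 ps \<open>b + r + o1 = k\<close> by (auto simp: top_items_def)
      qed
    next
      case False
      then have "k < b + r + o1" using osk o1 by force
      moreover have "o1 \<le> w" using w so o1 by auto
      ultimately have lt: "k < b + r + w" by simp
      obtain ps hi where ps: "os = ps @ w # hi" using w by (metis split_list)
      have "\<exists>i\<in>set (attach_all (ps @ w # hi) [] (with_open [] ?T) r (K + r) u). item_ok s k ?T Q v i"
        by (rule attach_all_ok[OF Br.prems(1) _ _ v(2) _ Br.prems(2,3) v(1) Br.prems(10)])
          (use ps K lt in auto)
      then have "\<exists>i\<in>set (attach_all os [] (Br r b l t []) r (K + r) u). item_ok s k ?T Q v i" using ps by simp
      then show ?thesis using o1 False by (auto simp: top_items_def simp del: attach_all.simps)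
    qed
  qed
qed

section \<open>The two sides together\<close>

definition cross :: "bool \<Rightarrow> nat set \<Rightarrow> nat set \<Rightarrow> vertex set set" where
  "cross s M N = {{(s, x), (\<not> s, y)} |x y. x \<in> M \<and> y \<in> N}"

lemma cross_swap: "cross s M N = cross (\<not> s) N M"
  by (auto simp: cross_def doubleton_eq_iff)

lemma image_cross: "(\<lambda>m. {(s, a), (\<not> s, m)}) ` N = cross s {a} N"
  by (auto simp: cross_def)

lemma cross_insert: "cross s (insert a M) N = cross s {a} N \<union> cross s M N"
  by (auto simp: cross_def)

lemma outside_cross: "outside s L (cross t M N)"
  by (auto simp: outside_def cross_def doubleton_eq_iff)

lemma outside_pset_other: "outside s L (pset (\<not> s) R)"
  by (auto simp: outside_def pset_def doubleton_eq_iff)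

lemma in_cross: "{(s, x), (\<not> s, y)} \<in> cross s M N \<longleftrightarrow> x \<in> M \<and> y \<in> N"
  by (auto simp: cross_def doubleton_eq_iff)

lemma cross_not_pset: "{(s, x), (\<not> s, y)} \<notin> pset t R"
  by (cases t; cases s; auto simp: pset_def doubleton_eq_iff)

definition world :: "bool \<Rightarrow> tree \<Rightarrow> tree \<Rightarrow> vertex set set" where
  "world s T S = pset s (det T) \<union> pset (\<not> s) (det S) \<union> cross s (set (members T)) (set (members S))"

lemma world_swap: "world s T S = world (\<not> s) S T"
  unfolding world_def using cross_swap[of s] by auto

text \<open>Two indices, because a branch first enters the deficit \<open>k\<close>, and only then
  does \<open>cover\<close> update the queues: in between, the deficits up to \<open>k\<close> are
  recorded while the open heights still obey the bound for \<open>k\<close>.\<close>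

definition state_ok :: "bool \<Rightarrow> nat \<Rightarrow> nat \<Rightarrow> tree \<Rightarrow> tree \<Rightarrow> trie \<Rightarrow> unit list \<Rightarrow> bool" where
  "state_ok s j k T S u n \<longleftrightarrow> sat s j T \<and> sat (\<not> s) j S \<and> rep T = 0 \<and> rep S = 0 \<and> (\<forall>x\<in>low T \<union> low S. x < k)
     \<and> recorded (world s T S) u \<and> (\<forall>e<k. has e u) \<and> length n + card (set (members T)) + card (set (members S)) = 18"

lemma state_ok_swap: "state_ok s j k T S u n = state_ok (\<not> s) j k S T u n"
  unfolding state_ok_def world_swap[of s] by auto

lemma recorded_has_mono: "\<lbrakk>recorded P u; recorded P' u'; P \<subseteq> P'; has e u\<rbrakk> \<Longrightarrow> has e u'"
  unfolding recorded_def by blast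

lemma cover_ok:
  assumes "state_ok True k (Suc k) A B u n"
  shows "\<exists>A' B' u'. cover k A B u n = [St A' B' u' n] \<and> state_ok True (Suc k) (Suc k) A' B' u' n"
proof -
  let ?C = "cross True (set (members A)) (set (members B))"
  have a: "sat True k A" "sat False k B" "recorded (world True A B) u" "has k u" using assms by (auto simp: state_ok_def)
  have w1: "world True A B = (pset False (det B) \<union> ?C) \<union> pset True (det A)" by (auto simp: world_def)
  have o1: "outside True (set (members A)) (pset False (det B) \<union> ?C)"
    unfolding outside_Un using outside_cross outside_pset_other[of True] by simp
  obtain A' u1 where 1: "adv A k u = Some (A', u1)" "sat True (Suc k) A'" "rep A' = rep A" "set (members A') = set (members A)"
     "low A' \<subseteq> low A" "has k u1" "det A \<subseteq> det A'" "recorded ((pset False (det B) \<union> ?C) \<union> pset True (det A')) u1"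
    using adv_ok[OF a(1) o1 a(3)[unfolded w1] a(4)] by blast
  have w2: "(pset False (det B) \<union> ?C) \<union> pset True (det A') = (pset True (det A') \<union> ?C) \<union> pset False (det B)" by auto
  have o2: "outside False (set (members B)) (pset True (det A') \<union> ?C)"
    unfolding outside_Un using outside_cross outside_pset_other[of False] by simp
  obtain B' u2 where 2: "adv B k u1 = Some (B', u2)" "sat False (Suc k) B'" "rep B' = rep B" "set (members B') = set (members B)"
     "low B' \<subseteq> low B" "has k u2" "det B \<subseteq> det B'" "recorded ((pset True (det A') \<union> ?C) \<union> pset False (det B')) u2"
    using adv_ok[OF a(2) o2 1(8)[unfolded w2] 1(6)] by blast
  have w3: "(pset True (det A') \<union> ?C) \<union> pset False (det B') = world True A' B'" by (auto simp: world_def 1(4) 2(4))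
  have sub: "world True A B \<subseteq> world True A' B'" using 1(4,7) 2(4,7) by (auto simp: world_def pset_def)
  have r: "recorded (world True A' B') u2" using 2(8) w3 by simp
  have "\<forall>e<Suc k. has e u2" using assms recorded_has_mono[OF a(3) r sub] by (simp add: state_ok_def)
  moreover have "\<forall>x\<in>low A' \<union> low B'. x < Suc k" using assms 1(5) 2(5) unfolding state_ok_def by blast
  ultimately have "state_ok True (Suc k) (Suc k) A' B' u2 n"
    using assms 1 2 r by (simp add: state_ok_def)
  moreover have "cover k A B u n = [St A' B' u2 n]" using 1(1) 2(1) by (simp add: cover_def)
  ultimately show ?thesis by blast
qed

lemma card_members: "card (set (members T) \<union> M) + card (set (members S) \<union> N) \<le> 18"
  if "set (members T) \<union> M \<subseteq> X s" "set (members S) \<union> N \<subseteq> X (\<not> s)"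
proof -
  have fin: "finite (X t)" for t using height by (meson finite_nat_set_iff_bounded_le)
  have "card (X s) + card (X (\<not> s)) = 18" using card by (cases s) (auto simp: add.commute)
  then show ?thesis using card_mono[OF fin that(1)] card_mono[OF fin that(2)] by simp
qed

text \<open>Paired with the far endpoint, a vertex of height \<open>x\<close> has deficit
  \<open>x\<close>. This deficit is recorded, and by injectivity it is this very pair that
  is.\<close>

lemma known:
  assumes "state_ok s j k T S u n" "x \<in> X s" "x < k"
  shows "x \<in> set (members T)"
proof -
  have "has x u" "recorded (world s T S) u" using assms by (auto simp: state_ok_def)
  then obtain p q where pq: "{p, q} \<in> world s T S" "dd p q = x" "world s T S \<subseteq> pairs" unfolding recorded_def by blast
  have v: "{(s, x), (\<not> s, 0)} \<in> pairs" using assms(2) zero by (simp add: in_pairs valid_def)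
  have "{p, q} = {(s, x), (\<not> s, 0)}"
    by (rule pair_eqD) (use pq v dd_diff[of s "\<not> s" x 0] in auto)
  then have "{(s, x), (\<not> s, 0)} \<in> world s T S" using pq by simp
  then show ?thesis by (simp add: world_def cross_not_pset in_cross)
qed

lemma new_on_side:
  assumes ok: "state_ok s k k T S u n" and v: "v \<in> X s" "v \<notin> set (members T)"
    and T': "sat s k T'" "rep T' = 0" "\<forall>x\<in>low T'. x < Suc k" "set (members T') = insert v (set (members T))"
    and rec: "recorded (pset s (det T') \<union> pset (\<not> s) (det S) \<union> cross s (set (members T)) (set (members S))) u'"
    and old: "\<forall>e<k. has e u'"  and new: "has k u' \<or> v = k"
  shows "\<exists>m n' u''. n = m # n' \<and> recs (members S) v u' = Some u'' \<and> state_ok s k (Suc k) T' S u'' n'"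
proof -
  let ?O = "set (members S)" and ?P = "pset s (det T') \<union> pset (\<not> s) (det S) \<union> cross s (set (members T)) (set (members S))"
  have S: "sat (\<not> s) k S" and T: "sat s k T" using ok by (auto simp: state_ok_def)
  note Sm = sat_members[OF S] and Tm = sat_members[OF T]
  \<comment> \<open>There are 18 heights in all, so \<open>v\<close> leaves the counter of missing
    vertices no room to be 0.\<close>
  have c: "card (insert v (set (members T))) + card ?O \<le> 18"
    using card_members[of T "{v}" s S "{}"] v Tm Sm by simp
  then have "length n \<noteq> 0" using ok v by (auto simp: state_ok_def)
  then obtain m n' where n: "n = m # n'" by (cases n) auto
  have "\<exists>u''. recs (members S) v u' = Some u'' \<and> recorded (?P \<union> (\<lambda>m. {(s, v), (\<not> s, m)}) ` ?O) u''"
  proof (rule recs_recorded[OF rec])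
    show "distinct (members S)" using Sm by simp
    fix m assume m: "m \<in> ?O"
    then have "{(s, v), (\<not> s, m)} \<in> pairs" using v Sm by (auto simp: in_pairs valid_def)
    then show "{(s, v), (\<not> s, m)} \<in> pairs - ?P \<and> dd (s, v) (\<not> s, m) = v + m"
      using v by (simp add: cross_not_pset in_cross dd_diff)
  qed
  then obtain u'' where u'': "recs (members S) v u' = Some u''" "recorded (?P \<union> cross s {v} ?O) u''" unfolding image_cross by blast
  have w: "?P \<union> cross s {v} ?O = world s T' S" unfolding world_def T'(4) cross_insert[of s v "set (members T)"] by auto
  have rw: "recorded (world s T' S) u''" using u''(2) w by simp
  have mono: "has e u''" if "has e u'" for e using recorded_has_mono[OF rec u''(2) Un_upper1 that] .
  have "has k u''"
  proof (cases "v = k")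
    case True
    have "0 \<in> ?O" using Sm ok by (auto simp: state_ok_def)
    then have "{(s, k), (\<not> s, 0)} \<in> world s T' S" using True T'(4) by (simp add: world_def in_cross)
    then show ?thesis using rw dd_diff[of s "\<not> s" k 0] unfolding recorded_def by auto
  qed (use new mono in auto)
  then have "\<forall>e<Suc k. has e u''" using old mono by (auto simp: less_Suc_eq)
  then have "state_ok s k (Suc k) T' S u'' n'"
    using ok T' rw n v unfolding state_ok_def by (auto simp: less_Suc_eq)
  then show ?thesis using u'' n by blast
qed

lemma results_new:
  assumes ok: "state_ok s k k T S u n" and k: "k \<in> X s" "k \<notin> set (members T)"
  shows "\<exists>T' u' n'. Res T' u' n' \<in> set (results (k \<le> 76) T k K u n (members S)) \<and> state_ok s k (Suc k) T' S u' n'"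
proof -
  have T: "sat s k T" "rep T = 0" "\<forall>x\<in>low T. x < k" "\<forall>e<k. has e u" using ok by (auto simp: state_ok_def)
  note Tm = sat_members[OF T(1)]
  have z0: "0 \<in> X s" by (rule zero)
  have k0: "0 < k" using Tm T(2) k(2) by (metis gr0I)
  have dk: "k \<le> dd (s, 0) (s, k)" using dd_same[OF z0 k(1)] height[OF z_in[OF z0 k(1)]] by simp
  have "sat s k (put k T)"
    by (rule sat_put[OF T(1)]) (use dk k k0 T in \<open>auto simp: open_ok_def\<close>)
  moreover have "recorded (pset s (det T) \<union> pset (\<not> s) (det S) \<union> cross s (set (members T)) (set (members S))) u"
    using ok by (simp add: state_ok_def world_def)
  ultimately obtain m n' u'' where n: "n = m # n'" "recs (members S) k u = Some u''" "state_ok s k (Suc k) (put k T) S u'' n'"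
    using new_on_side[OF ok k, of "put k T" u] T by (auto simp: less_Suc_eq)
  have "Res (put k T) u'' n' \<in> set (new_vertex (k \<le> 76) k T u n (members S))"
    using n height[OF k(1)] by simp
  then show ?thesis using n(3) by (auto simp: results_def)
qed

lemma results_same:
  assumes ok: "state_ok s k k T S u n" and xy: "x \<in> X s" "y \<in> X s" "x \<noteq> y" "dd (s, x) (s, y) = k"
    and nk: "\<not> has k u" and K: "K + k = 153"
  shows "\<exists>T' u' n'. Res T' u' n' \<in> set (results (k \<le> 76) T k K u n (members S)) \<and> state_ok s k (Suc k) T' S u' n'"
proof -
  let ?C = "cross s (set (members T)) (set (members S))"
  let ?Q = "pset (\<not> s) (det S) \<union> ?C"
  have T: "sat s k T" "rep T = 0" "\<forall>x\<in>low T. x < k" "recorded (world s T S) u" "\<forall>e<k. has e u" using ok by (auto simp: state_ok_def)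
  have z76: "z s x y \<le> 76" using height[OF z_in[OF xy(1,2)]] .
  \<comment> \<open>As \<open>2 * z s x y \<le> 152\<close>, the deficit exceeds the sum of the two
    heights.\<close>
  have "x < k" "y < k" using dd_same[OF xy(1,2)] xy(4) z76 by auto
  then have m: "x \<in> set (members T)" "y \<in> set (members T)" using known[OF ok] xy by auto
  have w: "world s T S = ?Q \<union> pset s (det T)" by (auto simp: world_def)
  have out: "outside s (set (members T)) ?Q"
    unfolding outside_Un using outside_cross outside_pset_other by simp
  have out': "{(s, a), (s, b)} \<notin> ?Q" for a b
    using outside_cross[of s "{a, b}" s] outside_pset_other[of s "{a, b}"] by (auto simp: outside_def)
  have "\<exists>i\<in>set (items T k K u). item_ok s k T ?Q (z s x y) i"
    by (rule items_ok[OF T(1) out T(4)[unfolded w] m xy(3,4) nk refl _ K]) (use out' in blast)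
  then obtain i where i: "i \<in> set (items T k K u)" "item_ok s k T ?Q (z s x y) i" by blast
  have mono: "\<forall>e<k. has e u'" if "recorded (?Q \<union> pset s (det T')) u'" "det T \<subseteq> det T'" for T' u'
  proof -
    have "pset s (det T) \<subseteq> pset s (det T')" using that(2) by (auto simp: pset_def)
    then have "?Q \<union> pset s (det T) \<subseteq> ?Q \<union> pset s (det T')" by blast
    then show ?thesis using recorded_has_mono[OF T(4)[unfolded w] that(1)] T(5) by blast
  qed
  show ?thesis
  proof (cases i)
    case (Done T' u')
    then have T': "tree_ok s k T ?Q (set (members T)) T' u'" using i by simp
    have "?Q \<union> pset s (det T') = world s T' S" using T' by (auto simp: world_def tree_ok_def)
    then have "state_ok s k (Suc k) T' S u' n"
      using ok T' mono[of T' u'] unfolding state_ok_def tree_ok_def by (auto simp: less_Suc_eq)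
    moreover have "Res T' u' n \<in> set (results (k \<le> 76) T k K u n (members S))"
      using i(1) Done by (auto simp: results_def set_maps intro!: bexI[of _ i])
    ultimately show ?thesis by blast
  next
    case (Pend v T' u')
    then have v: "v = z s x y" "v \<notin> set (members T)" and T': "tree_ok s k T ?Q (insert v (set (members T))) T' u'" using i by auto
    have "\<exists>m n' u''. n = m # n' \<and> recs (members S) v u' = Some u'' \<and> state_ok s k (Suc k) T' S u'' n'"
    proof (rule new_on_side[OF ok _ v(2)])
      show "v \<in> X s" using v z_in xy by simp
      show "\<forall>x\<in>low T'. x < Suc k" using T' T(3) by (auto simp: tree_ok_def less_Suc_eq)
      have "pset s (det T') \<union> pset (\<not> s) (det S) \<union> ?C = ?Q \<union> pset s (det T')" by auto
      then show "recorded (pset s (det T') \<union> pset (\<not> s) (det S) \<union> ?C) u'" using T' by (simp add: tree_ok_def)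
    qed (use T' T mono[of T' u'] in \<open>auto simp: tree_ok_def\<close>)
    then obtain m n' u'' where n: "n = m # n'" "recs (members S) v u' = Some u''" "state_ok s k (Suc k) T' S u'' n'" by blast
    have "Res T' u'' n' \<in> set (results (k \<le> 76) T k K u n (members S))"
      using i(1) Pend n by (auto simp: results_def set_maps intro!: bexI[of _ i])
    then show ?thesis using n(3) by blast
  qed
qed

lemma step_ok:
  assumes ok: "state_ok True k k A B u n" and k: "k < 153"
  shows "\<exists>A' B' u' n'. St A' B' u' n' \<in> set (step (lev k) (St A B u n)) \<and> state_ok True (Suc k) (Suc k) A' B' u' n'"
proof (cases "has k u")
  case True
  then have "state_ok True k (Suc k) A B u n" using ok by (auto simp: state_ok_def less_Suc_eq)
  then show ?thesis using cover_ok True by (fastforce simp: lev_def)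
next
  case False
  obtain p q where pq: "valid p" "valid q" "p \<noteq> q" "dd p q = k" using surj[OF k] by blast
  have ok': "state_ok False k k B A u n" using ok state_ok_swap[of True] by simp
  define goal where "goal s T S \<longleftrightarrow> (\<exists>T' u' n'. Res T' u' n' \<in> set (results (k \<le> 76) T k (153 - k) u n (members S)) \<and> state_ok s k (Suc k) T' S u' n')" for s T S
  have "goal True A B \<or> goal False B A"
  proof (cases "fst p = fst q")
    case True
    then obtain s x y where xy: "p = (s, x)" "q = (s, y)" by (cases p; cases q) auto
    show ?thesis
      using results_same[OF ok, of x y "153 - k"] results_same[OF ok', of x y "153 - k"] xy pq False k
      by (cases s) (auto simp: goal_def valid_def)
  next
    case F: False
    have "\<exists>x y. {p, q} = {(True, x), (False, y)}"
      using F by (cases p; cases q; case_tac a; case_tac aa) (auto simp: doubleton_eq_iff)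
    then obtain x y where xy: "{p, q} = {(True, x), (False, y)}" by blast
    then have X: "x \<in> X True" "y \<in> X False" and d: "x + y = k"
      using pq F by (auto simp: doubleton_eq_iff valid_def dd_def)
    have "\<not> (x \<in> set (members A) \<and> y \<in> set (members B))"
    proof
      assume "x \<in> set (members A) \<and> y \<in> set (members B)"
      then have "{(True, x), (False, y)} \<in> world True A B" using in_cross[of True] by (auto simp: world_def)
      moreover have "dd (True, x) (False, y) = k" using d by (simp add: dd_def)
      ultimately show False using ok False unfolding state_ok_def recorded_def by blast
    qed
    \<comment> \<open>A vertex that is not known has height at least \<open>k\<close>. The two
      heights add up to \<open>k\<close>, so it has height \<open>k\<close> and its partner is the
      far endpoint.\<close>
    then consider "x \<notin> set (members A)" | "y \<notin> set (members B)" by blast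
    then show ?thesis
    proof cases
      case 1
      then have "x = k" using known[OF ok X(1)] d by fastforce
      then show ?thesis using results_new[OF ok, of "153 - k"] X 1 by (auto simp: goal_def)
    next
      case 2
      then have "y = k" using known[OF ok' X(2)] d by fastforce
      then show ?thesis using results_new[OF ok', of "153 - k"] X 2 by (auto simp: goal_def)
    qed
  qed
  moreover have "k \<le> 76 \<or> n = []"
  proof (rule ccontr)
    assume a: "\<not> ?thesis"
    have "X s \<subseteq> set (members T)" if "state_ok s k k T S u n" for s T S
      using known[OF that] height a by fastforce
    from this[OF ok] this[OF ok'] have "X True = set (members A)" "X False = set (members B)"
      using ok sat_members[of True k A] sat_members[of False k B] by (auto simp: state_ok_def)
    then have c: "card (set (members A)) + card (set (members B)) = 18" using card by simp
    have "length n + card (set (members A)) + card (set (members B)) = 18" using ok by (simp add: state_ok_def)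
    then have "length n = 0" using c by linarith
    then show False using a by simp
  qed
  then have st: "step (lev k) (St A B u n) = branch (k \<le> 76) k (153 - k) A B u n"
    using False by (auto simp: lev_def)
  ultimately show ?thesis
  proof (elim disjE)
    assume "goal True A B"
    then obtain A' u' n' where r: "Res A' u' n' \<in> set (results (k \<le> 76) A k (153 - k) u n (members B))" "state_ok True k (Suc k) A' B u' n'"
      by (auto simp: goal_def)
    obtain A2 B2 u2 where c: "cover k A' B u' n' = [St A2 B2 u2 n']" "state_ok True (Suc k) (Suc k) A2 B2 u2 n'" using cover_ok[OF r(2)] by blast
    have "St A2 B2 u2 n' \<in> set (branch (k \<le> 76) k (153 - k) A B u n)"
      unfolding branch_def set_append set_maps by (rule UnI1) (rule UN_I[OF r(1)], use c in simp)
    then show ?thesis using c(2) st by auto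
  next
    assume "goal False B A"
    then obtain B' u' n' where r: "Res B' u' n' \<in> set (results (k \<le> 76) B k (153 - k) u n (members A))" "state_ok False k (Suc k) B' A u' n'"
      by (auto simp: goal_def)
    then have "state_ok True k (Suc k) A B' u' n'" using state_ok_swap[of False] by simp
    then obtain A2 B2 u2 where c: "cover k A B' u' n' = [St A2 B2 u2 n']" "state_ok True (Suc k) (Suc k) A2 B2 u2 n'" using cover_ok by blast
    have "St A2 B2 u2 n' \<in> set (branch (k \<le> 76) k (153 - k) A B u n)"
      unfolding branch_def set_append set_maps by (rule UnI2) (rule UN_I[OF r(1)], use c in simp)
    then show ?thesis using c(2) st by auto
  qed
qed

lemma refuted_sound:
  assumes "state_ok True k k A B u n" "k + m \<le> 153"
  shows "\<not> refuted (map lev [k..<k + m]) (St A B u n)"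
  using assms
proof (induction m arbitrary: k A B u n)
  case 0
  then show ?case by simp
next
  case (Suc m)
  obtain A' B' u' n' where s: "St A' B' u' n' \<in> set (step (lev k) (St A B u n))" "state_ok True (Suc k) (Suc k) A' B' u' n'"
    using step_ok[OF Suc.prems(1)] Suc.prems(2) by auto
  have "\<not> refuted (map lev [Suc k..<Suc k + m]) (St A' B' u' n')" using Suc.IH[OF s(2)] Suc.prems(2) by simp
  moreover have "[k..<k + Suc m] = k # [Suc k..<Suc k + m]" by (simp add: upt_rec)
  ultimately show ?case using s(1) by (auto simp: list_all_iff simp del: step.simps)
qed

section \<open>The initial state and the symmetry of the sides\<close>

lemma init_ok:
  assumes one: "1 \<in> X True"
  shows "\<exists>A B u n. init = St A B u n \<and> state_ok True 2 2 A B u n"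
proof -
  define A where "A = Lf 0 [1]"
  define B where "B = Lf 0 []"
  define u where "u = ins_num num.One Tip"
  define n where "n = replicate 15 ()"
  have i: "init = St A B u n"
    by (simp add: init_def A_def B_def u_def n_def numeral_eq_Suc)
  have z: "0 \<in> X s" for s by (rule zero)
  have w: "world True A B = {{(True, 0), (False, 0)}, {(True, 1), (False, 0)}}"
    by (auto simp: world_def A_def B_def pset_def cross_def)
  have P: "{(True, 0), (False, 0)} \<in> pairs" "{(True, 1), (False, 0)} \<in> pairs" "{(True, 0), (True, 1)} \<in> pairs"
    using z one by (auto simp: in_pairs valid_def)
  have has: "has e u \<longleftrightarrow> e = 0 \<or> e = 1" for e
  proof -
    have "has e u \<longleftrightarrow> e = 0 \<or> num_of_nat e = num.One"
      by (simp only: has_def u_def mem_num_ins mem_num.simps simp_thms)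
    moreover have "e = 1" if "num_of_nat e = num.One" "e \<noteq> 0"
      using that num_of_nat_inverse[of e] by simp
    ultimately show ?thesis by auto
  qed
  have d: "dd (True, 0) (False, 0) = 0" "dd (False, 0) (True, 0) = 0" "dd (True, 1) (False, 0) = 1" "dd (False, 0) (True, 1) = 1"
    by (simp_all add: dd_def)
  have rec: "recorded (world True A B) u"
    unfolding recorded_def
  proof (intro conjI allI)
    show "world True A B \<subseteq> pairs" using P w by auto
    fix e show "has e u \<longleftrightarrow> (\<exists>p q. {p, q} \<in> world True A B \<and> dd p q = e)"
    proof
      assume "has e u"
      then have "e = 0 \<or> e = 1" by (simp add: has)
      then show "\<exists>p q. {p, q} \<in> world True A B \<and> dd p q = e" using d w by (metis insertCI)
    next
      assume "\<exists>p q. {p, q} \<in> world True A B \<and> dd p q = e"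
      then show "has e u" using d by (auto simp: has w doubleton_eq_iff)
    qed
  qed
  \<comment> \<open>Deficits 0 and 1 belong to other pairs; this gives the lower bound that the open
    height 1 needs at level 2.\<close>
  have "\<not> has (dd (True, 0) (True, 1)) u"
    by (rule recorded_fresh[OF rec P(3)]) (auto simp: w doubleton_eq_iff)
  then have "2 \<le> dd (True, 0) (True, 1)" by (auto simp: has)
  then have "sat True 2 A" "sat False 2 B" using z one by (auto simp: A_def B_def open_ok_def)
  then have "state_ok True 2 2 A B u n"
    using rec by (auto simp: state_ok_def has A_def B_def n_def)
  then show ?thesis using i by blast
qed

lemma one: "1 \<in> X True \<or> 1 \<in> X False"
proof -
  obtain p q where pq: "valid p" "valid q" "p \<noteq> q" "dd p q = 1" using surj[of 1] by auto
  obtain s x t y where xy: "p = (s, x)" "q = (t, y)" by (cases p; cases q) auto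
  have X: "x \<in> X s" "y \<in> X t" using pq xy by (auto simp: valid_def)
  \<comment> \<open>Within a side the two heights differ and the median has height at most 76, so
    the deficit is at least 2.\<close>
  have "s \<noteq> t"
  proof
    assume "s = t"
    then have "dd (s, x) (s, y) + 2 * z s x y = 153 + x + y" "z s x y \<le> 76" "x \<noteq> y"
      using dd_same[of x s y] height[OF z_in[of x s y]] X pq xy by auto
    then show False using pq xy \<open>s = t\<close> by auto
  qed
  then have "x + y = 1" using pq xy by (auto simp: dd_def)
  then have "x = 1 \<or> y = 1" by auto
  then show ?thesis using X by (cases s; cases t) auto
qed

lemma not_refuted: "1 \<in> X True \<Longrightarrow> \<not> refuted (map lev [2..<153]) init"
  using init_ok refuted_sound[of 2 _ _ _ _ 151] by fastforce

end

text \<open>Justifies starting with height 1 on the side \<open>True\<close>.\<close>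

lemma solution_swap:
  assumes "solution X z"
  shows "solution (\<lambda>s. X (\<not> s)) (\<lambda>s. z (\<not> s))"
proof -
  interpret solution X z by (rule assms)
  let ?f = "map_prod Not id :: vertex \<Rightarrow> vertex"
  have d: "deficit (\<lambda>s. z (\<not> s)) p q = dd (?f p) (?f q)" for p q
    by (simp add: deficit_def)
  have ff: "?f (?f p) = p" for p by (cases p) simp
  have inj': "?f p = ?f q \<longleftrightarrow> p = q" for p q using ff by metis
  have fs: "fst (?f p) = (\<not> fst p)" "snd (?f p) = snd p" for p by simp_all
  show ?thesis
  proof (unfold_locales, goal_cases)
    case (10 p q p' q')
    have "{?f p, ?f q} = {?f p', ?f q'}"
      by (rule deficit_inj) (use 10 d in \<open>simp_all only: fs inj' not_False_eq_True\<close>)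
    then show ?case using inj' by (simp only: doubleton_eq_iff)
  next
    case (11 k)
    then obtain p q where pq: "snd p \<in> X (fst p)" "snd q \<in> X (fst q)" "p \<noteq> q" "dd p q = k" using deficit_surj by blast
    then show ?case
      by (rule_tac exI[of _ "?f p"], rule_tac exI[of _ "?f q"]) (use pq in \<open>simp only: fs inj' d ff not_not simp_thms\<close>)
  qed (use height zero card z_in z_same z_sym z_ge z_absorb ultra in \<open>auto simp: add.commute\<close>)
qed

lemma no_solution:
  assumes "refuted (map lev [2..<153]) init"
  shows "\<not> solution X z"
proof
  assume s: "solution X z"
  show False
    using solution.one[OF s] solution.not_refuted[OF s] solution.not_refuted[OF solution_swap[OF s]] assms by auto
qed

section \<open>Running the search\<close>

primrec frontier :: "level list \<Rightarrow> state list \<Rightarrow> state list" where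
  "frontier [] ss = ss" | "frontier (l # ls) ss = frontier ls (maps (step l) ss)"

text \<open>The search is run by rewriting alone. Each equation below is unconditional, and every case distinction is made
  by a function of its own that matches on an evaluated argument: the simplifier would rewrite the branches
  of an \<open>if\<close> or \<open>case\<close> repeatedly, and conditional equations cost it a recursive call each.
  Numerals keep the form \<open>numeral n\<close> throughout, which is why \<open>numeral num.One\<close> occurs instead of \<open>1\<close>.\<close>

fun members_acc :: "tree \<Rightarrow> nat list \<Rightarrow> nat list" where
  "members_acc (Lf r os) acc = r # os @ acc"
| "members_acc (Br r b l t os) acc = members_acc l (members_acc t (os @ acc))"

lemma members_exec: "members T = members_acc T []"
proof -
  have "members_acc T acc = members T @ acc" for acc by (induction T arbitrary: acc) auto
  then show ?thesis by simp
qed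

lemma has_exec: "has 0 u = True" "has (numeral n) u = mem_num n u" "ins (numeral n) u = ins_num n u"
  by (simp_all add: has_def ins_def num_of_nat_numeral_eq)

fun recs2 where
  "recs2 True e ms c u = None"
| "recs2 False e ms c u = recs ms c (ins e u)"

definition "recs1 e ms c u = recs2 (has e u) e ms c u"

lemma recs_exec: "recs [] c u = Some u" "recs (m # ms) c u = recs1 (c + m) ms c u"
  by (simp_all add: recs1_def)

fun adv4 where
  "adv4 None r b l t xs = None"
| "adv4 (Some u) r b l t xs = Some (Br r b l t xs, u)"

fun adv3 where
  "adv3 False r b l t x xs u = Some (Br r b l t (x # xs), u)"
| "adv3 True r b l t x xs u = adv4 (recs (members t) (b + x) u) r b (put x l) t xs"

fun adv2 where
  "adv2 None r b l os k = None"
| "adv2 (Some (t, u)) r b l os k = adv_top k r b l t os u"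

fun adv1 where
  "adv1 None r b t os k = None"
| "adv1 (Some (l, u)) r b t os k = adv2 (adv t k u) r b l os k"

lemma adv_exec: "adv (Lf r os) k u = Some (Lf r os, u)"
  "adv (Br r b l t os) k u = adv1 (adv l k u) r b t os k"
  "adv_top k r b l t [] u = Some (Br r b l t [], u)"
  "adv_top k r b l t (x # xs) u = adv3 (b + r + x = k) r b l t x xs u"
  by (auto simp: adv_top_def split: option.split) (cases "recs (members t) (b + x) u"; simp)

fun place where
  "place False z os T u = [Pend z T u]"
| "place True z os T u = [Done (with_open (remove1 z os) T) u]"

fun try_place where
  "try_place None z os T = []"
| "try_place (Some u) z os T = place (z \<in> set os) z os T u"

fun attach3 where
  "attach3 True ms r b S x os z u = [Done (Br r b S (Lf z []) os) u]"
| "attach3 False ms r b S x os z u =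
     try_place (recs (x # ms) (b + z) u) z os (Br r b S (Br x b (Lf x []) (Lf z []) []) os)"

fun attach2 where
  "attach2 None ms r b S x os z = []"
| "attach2 (Some u) ms r b S x os z = attach3 (z = x) ms r b S x os z u"

definition "attach1 ms b r S x os z u = attach2 (recs ms (b + x) u) ms r b S x os z"

lemma attach_exec: "attach r S x os z u = attach1 (members S) (lab z) r S x os z u"
  by (simp add: attach_def attach1_def Let_def del: recs.simps split: option.split)

definition "attach_all1 y x os lo S r q u =
  (if even y then attach r (with_open lo S) x os (y div 2) u else []) @ attach_all os (lo @ [x]) S r q u"

lemma attach_all_exec: "attach_all [] lo S r q u = []"
  "attach_all (x # os) lo S r q u = attach_all1 (q + x) x os lo S r q u"
  "attach_all1 (numeral num.One) x os lo S r q u = attach_all os (lo @ [x]) S r q u"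
  "attach_all1 (numeral (num.Bit1 n)) x os lo S r q u = attach_all os (lo @ [x]) S r q u"
  "attach_all1 (numeral (num.Bit0 n)) x os lo S r q u =
     attach r (with_open lo S) x os (numeral n) u @ attach_all os (lo @ [x]) S r q u"
  by (simp_all add: attach_all1_def)

fun settle where
  "settle None T = []"
| "settle (Some u) T = [Done T u]"

fun split_off1 where
  "split_off1 None r b l t x os = []"
| "split_off1 (Some u) r b l (Lf z zs) x os = settle (recs [z] (b + x) u) (Br r b l (Br x b (Lf x []) (Lf z zs) []) os)"
| "split_off1 (Some u) r b l (Br r' b' l' t' os') x os = [Done (Br r b l (put x (Br r' b' l' t' os')) os) u]"

lemma split_off_exec: "split_off r b l t x os u = split_off1 (recs (members l) (b + x) u) r b l t x os"
  by (simp add: split_off_def del: recs.simps split: option.split tree.split)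

fun top_items1 where
  "top_items1 True K r b l t x xs u = split_off r b l t x xs u @ attach_all xs [x] (Br r b l t []) r (K + r) u"
| "top_items1 False K r b l t x xs u = attach_all (x # xs) [] (Br r b l t []) r (K + r) u"

lemma top_items_exec: "top_items k K r b l t [] u = []"
  "top_items k K r b l t (x # xs) u = top_items1 (b + r + x = k) K r b l t x xs u"
  by (simp_all add: top_items_def)

lemma raise_exec: "raise_left r b t os (Done l u) = [Done (Br r b l t os) u]"
  "raise_left r b t os (Pend z l u) = try_place (recs (members t) (b + z) u) z os (Br r b l t os)"
  "raise_right r b l os (Done t u) = [Done (Br r b l t os) u]"
  "raise_right r b l os (Pend z t u) = try_place (recs (members l) (b + z) u) z os (Br r b l t os)"
  by (simp_all split: option.split)

fun spend where
  "spend None T n = []"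
| "spend (Some u) T n = [Res T u n]"

lemma finish_exec: "finish om n (Done T u) = [Res T u n]" "finish om [] (Pend z T u) = []"
  "finish om (x # n) (Pend z T u) = spend (recs om z u) T n"
  by (simp_all split: option.split)

lemma new_vertex_exec: "new_vertex True k T u (x # n) om = spend (recs om k u) (put k T) n"
  "new_vertex True k T u [] om = []" "new_vertex False k T u n om = []"
  by (simp_all split: option.split)

fun cover2 where
  "cover2 None A n = []"
| "cover2 (Some (B, u)) A n = [St A B u n]"

fun cover1 where
  "cover1 None k B n = []"
| "cover1 (Some (A, u)) k B n = cover2 (adv B k u) A n"

lemma cover_exec: "cover k A B u n = cover1 (adv A k u) k B n"
  by (simp add: cover_def split: option.split)

fun step2 where
  "step2 True k K A B u n = branch True k K A B u n"
| "step2 False k K A B u [] = branch False k K A B u []"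
| "step2 False k K A B u (x # xs) = []"

fun step1 where
  "step1 True early k K A B u n = cover k A B u n"
| "step1 False early k K A B u n = step2 early k K A B u n"

lemma step_exec: "step (Lev k K early) (St A B u n) = step1 (has k u) early k K A B u n"
  by (cases early; cases n; simp)

fun conj_strict where
  "conj_strict True x = x"
| "conj_strict False x = False"

lemma list_all_exec: "list_all P [] = True" "list_all P (x # xs) = conj_strict (P x) (list_all P xs)"
  by simp_all (cases "P x"; simp)

fun disj_strict where
  "disj_strict True x = True"
| "disj_strict False x = x"

lemma in_set_exec: "(z \<in> set []) = False" "(z \<in> set (x # xs)) = disj_strict (z = x) (z \<in> set xs)"
  by simp_all (cases "z = x"; simp)

fun remove_strict where
  "remove_strict True x xs ys = xs"
| "remove_strict False x xs ys = x # ys"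

lemma remove1_exec: "remove1 z [] = []" "remove1 z (x # xs) = remove_strict (z = x) x xs (remove1 z xs)"
  by simp_all

text \<open>The search also proposes branching heights above 76, for which the truncated subtraction yields 0.\<close>

lemma lab_num:
  "lab (numeral num.One) = 151" "lab 2 = 149" "lab 3 = 147" "lab 4 = 145" "lab 5 = 143" "lab 6 = 141" "lab 7 = 139"
  "lab 8 = 137" "lab 9 = 135" "lab 10 = 133" "lab 11 = 131" "lab 12 = 129" "lab 13 = 127" "lab 14 = 125"
  "lab 15 = 123" "lab 16 = 121" "lab 17 = 119" "lab 18 = 117" "lab 19 = 115" "lab 20 = 113" "lab 21 = 111"
  "lab 22 = 109" "lab 23 = 107" "lab 24 = 105" "lab 25 = 103" "lab 26 = 101" "lab 27 = 99" "lab 28 = 97"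
  "lab 29 = 95" "lab 30 = 93" "lab 31 = 91" "lab 32 = 89" "lab 33 = 87" "lab 34 = 85" "lab 35 = 83"
  "lab 36 = 81" "lab 37 = 79" "lab 38 = 77" "lab 39 = 75" "lab 40 = 73" "lab 41 = 71" "lab 42 = 69"
  "lab 43 = 67" "lab 44 = 65" "lab 45 = 63" "lab 46 = 61" "lab 47 = 59" "lab 48 = 57" "lab 49 = 55"
  "lab 50 = 53" "lab 51 = 51" "lab 52 = 49" "lab 53 = 47" "lab 54 = 45" "lab 55 = 43" "lab 56 = 41"
  "lab 57 = 39" "lab 58 = 37" "lab 59 = 35" "lab 60 = 33" "lab 61 = 31" "lab 62 = 29" "lab 63 = 27"
  "lab 64 = 25" "lab 65 = 23" "lab 66 = 21" "lab 67 = 19" "lab 68 = 17" "lab 69 = 15" "lab 70 = 13"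
  "lab 71 = 11" "lab 72 = 9" "lab 73 = 7" "lab 74 = 5" "lab 75 = 3" "lab 76 = numeral num.One" "lab 77 = 0"
  "lab 78 = 0" "lab 79 = 0" "lab 80 = 0" "lab 81 = 0" "lab 82 = 0" "lab 83 = 0" "lab 84 = 0"
  "lab 85 = 0" "lab 86 = 0" "lab 87 = 0" "lab 88 = 0" "lab 89 = 0" "lab 90 = 0" "lab 91 = 0"
  "lab 92 = 0" "lab 93 = 0" "lab 94 = 0" "lab 95 = 0" "lab 96 = 0" "lab 97 = 0" "lab 98 = 0"
  "lab 99 = 0" "lab 100 = 0" "lab 101 = 0" "lab 102 = 0" "lab 103 = 0" "lab 104 = 0" "lab 105 = 0"
  "lab 106 = 0" "lab 107 = 0" "lab 108 = 0" "lab 109 = 0" "lab 110 = 0" "lab 111 = 0" "lab 112 = 0"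
  "lab 113 = 0" "lab 114 = 0" "lab 115 = 0" "lab 116 = 0" "lab 117 = 0" "lab 118 = 0" "lab 119 = 0"
  "lab 120 = 0" "lab 121 = 0" "lab 122 = 0" "lab 123 = 0" "lab 124 = 0" "lab 125 = 0" "lab 126 = 0"
  "lab 127 = 0" "lab 128 = 0" "lab 129 = 0" "lab 130 = 0"
  by (simp_all add: lab_def)

lemma num_exec: "(0::nat) + numeral n = numeral n" "numeral n + (0::nat) = numeral n" "(0::nat) + 0 = 0"
  "((numeral m :: nat) = numeral n) = (m = n)" "((0 :: nat) = numeral n) = False" "((numeral n :: nat) = 0) = False" by simp_all

lemma eq_self: "(x = x) = True" by simp

lemma neq_num: "(num.One = num.Bit0 n) = False" "(num.One = num.Bit1 n) = False" "(num.Bit0 n = num.One) = False" "(num.Bit1 n = num.One) = False"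
  "(num.Bit0 m = num.Bit1 n) = False" "(num.Bit1 m = num.Bit0 n) = False" by simp_all

lemmas exec = mem_num.simps ins_num.simps has_exec members_exec members_acc.simps recs_exec recs1_def recs2.simps put.simps
  with_open.simps adv_exec adv1.simps adv2.simps adv3.simps adv4.simps attach_exec attach1_def attach2.simps attach3.simps
  place.simps try_place.simps attach_all_exec split_off_exec split_off1.simps settle.simps top_items_exec top_items1.simps
  raise_exec items.simps maps.simps finish_exec new_vertex_exec spend.simps results_def cover_exec cover1.simps cover2.simps
  coverA.simps coverB.simps branch_def step_exec step1.simps step2.simps refuted.simps frontier.simps list_all_exec
  conj_strict.simps in_set_exec disj_strict.simps remove1_exec remove_strict.simps append.simps
  lab_num num_exec eq_self neq_num num.inject add_num_simps numeral_plus_numeral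

text \<open>Expanding all branches through the first levels keeps the verdict, so the states in
  between can be listed once and refuted separately.\<close>

lemma frontier_append: "list_all (refuted (ls @ ls')) ss \<longleftrightarrow> list_all (refuted ls') (frontier ls ss)"
proof (induction ls arbitrary: ss)
  case (Cons l ls)
  have "list_all (refuted ((l # ls) @ ls')) ss \<longleftrightarrow> list_all (refuted (ls @ ls')) (maps (step l) ss)"
    by (induction ss) auto
  then show ?case using Cons.IH[of "maps (step l) ss"] by (simp only: frontier.simps)
qed simp

section \<open>Splitting the search into batches\<close>

definition early :: "level list" where "early = map lev [2..<8]"

definition late :: "level list" where "late = map lev [8..<153]"

definition states :: "state list" where "states = frontier early [init]"

text \<open>The level fields \<open>153 - k\<close> and \<open>k \<le> 76\<close> are computed
  beforehand, so that the search meets literals only.\<close>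

lemmas early_eq = early_def[simplified, unfolded lev_def, simplified]

lemmas late_eq = late_def[simplified, unfolded lev_def, simplified]

lemma unary: "take 0 xs = []" "take (Suc n) [] = []" "take (Suc n) (x # xs) = x # take n xs"
  "drop 0 xs = xs" "drop (Suc n) [] = []" "drop (Suc n) (x # xs) = drop n xs"
  by simp_all

text \<open>\<open>take\<close> and \<open>drop\<close> recurse on \<open>Suc\<close>. The
  conversion is applied while \<open>states\<close> and \<open>late\<close> are folded; it reaches
  only the batch bounds, and the numerals of the search stay binary.\<close>

lemmas to_unary = eval_nat_numeral BitM.simps numeral_One One_nat_def

lemmas search = exec early_eq late_eq states_def init_def unary

text \<open>The 58 states that are left after deficit 7 are refuted in batches, so that the batches can be checked in parallel.\<close>

lemma slice_0: "list_all (refuted late) (take 1 (drop 0 states))"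
  by (simp only: to_unary, simp only: search)

lemma slice_1: "list_all (refuted late) (take 8 (drop 1 states))"
  by (simp only: to_unary, simp only: search)

lemma slice_2: "list_all (refuted late) (take 3 (drop 9 states))"
  by (simp only: to_unary, simp only: search)

lemma slice_3: "list_all (refuted late) (take 7 (drop 12 states))"
  by (simp only: to_unary, simp only: search)

lemma slice_4: "list_all (refuted late) (take 2 (drop 19 states))"
  by (simp only: to_unary, simp only: search)

lemma slice_5: "list_all (refuted late) (take 2 (drop 21 states))"
  by (simp only: to_unary, simp only: search)

lemma slice_6: "list_all (refuted late) (take 6 (drop 23 states))"
  by (simp only: to_unary, simp only: search)

lemma slice_7: "list_all (refuted late) (take 5 (drop 29 states))"
  by (simp only: to_unary, simp only: search)

lemma slice_8: "list_all (refuted late) (take 18 (drop 34 states))"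
  by (simp only: to_unary, simp only: search)

lemma slice_9: "list_all (refuted late) (take 5 (drop 52 states))"
  by (simp only: to_unary, simp only: search)

lemma slice_10: "list_all (refuted late) (take 1 (drop 57 states))"
  by (simp only: to_unary, simp only: search)

lemma take_drop_all: "list_all P (drop a xs) \<longleftrightarrow> list_all P (take n (drop a xs)) \<and> list_all P (drop (a + n) xs)"
  by (metis append_take_drop_id drop_drop add.commute list_all_append)

lemma refuted_init: "refuted (map lev [2..<153]) init"
proof -
  have "[2..<153] = [2..<8] @ [8..<153::nat]" using upt_add_eq_append[of 2 8 145] by simp
  then have "map lev [2..<153] = early @ late" by (simp only: early_def late_def map_append)
  moreover have "list_all (refuted late) states"
  proof -
    \<comment> \<open>Needed to know that the batches exhaust the list.\<close>
    have len: "drop 58 states = []" by (simp only: to_unary, simp only: search)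
    note step = take_drop_all[of "refuted late" _ states]
    have "list_all (refuted late) (drop 0 states)"
      by (subst step[of 0 1], subst step[of "0+1" 8], subst step[of "0+1+8" 3], subst step[of "0+1+8+3" 7], subst step[of "0+1+8+3+7" 2],
        subst step[of "0+1+8+3+7+2" 2], subst step[of "0+1+8+3+7+2+2" 6], subst step[of "0+1+8+3+7+2+2+6" 5],
        subst step[of "0+1+8+3+7+2+2+6+5" 18], subst step[of "0+1+8+3+7+2+2+6+5+18" 5], subst step[of "0+1+8+3+7+2+2+6+5+18+5" 1],
        use slice_0 slice_1 slice_2 slice_3 slice_4 slice_5 slice_6 slice_7 slice_8 slice_9 slice_10 len in simp)
    then show ?thesis by simp
  qed
  ultimately have "list_all (refuted (early @ late)) [init]" using frontier_append[of early late "[init]"] by (simp add: states_def)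
  then show ?thesis using \<open>map lev [2..<153] = early @ late\<close> by simp
qed

section \<open>The heights of a Leech tree\<close>

locale leech_metric =
  fixes V :: "'a set" and d :: "'a \<Rightarrow> 'a \<Rightarrow> nat" and u v :: 'a
  assumes order: "finite V" "card V = 18"
    and self: "x \<in> V \<Longrightarrow> d x x = 0"
    and sym: "\<lbrakk>x \<in> V; y \<in> V\<rbrakk> \<Longrightarrow> d x y = d y x"
    and median: "\<lbrakk>e \<in> V; x \<in> V; y \<in> V\<rbrakk> \<Longrightarrow> \<exists>m\<in>V. d x e = d x m + d m e \<and> d y e = d y m + d m e \<and> d x y = d x m + d m y"
    and four_point: "\<lbrakk>e \<in> V; x \<in> V; y \<in> V; t \<in> V\<rbrakk> \<Longrightarrow> d x y + d e t \<le> max (d x t + d e y) (d t y + d e x)"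
    and dist_range: "\<lbrakk>x \<in> V; y \<in> V; x \<noteq> y\<rbrakk> \<Longrightarrow> d x y \<in> {1..153}"
    and dist_inj: "\<lbrakk>x \<in> V; y \<in> V; x \<noteq> y; x' \<in> V; y' \<in> V; x' \<noteq> y'; d x y = d x' y'\<rbrakk> \<Longrightarrow> {x, y} = {x', y'}"
    and dist_surj: "k \<in> {1..153} \<Longrightarrow> \<exists>x\<in>V. \<exists>y\<in>V. x \<noteq> y \<and> d x y = k"
    and diam: "u \<in> V" "v \<in> V" "d u v = 153"
begin

text \<open>For the side \<open>s\<close>, \<open>near s\<close> is the endpoint of the diameter on it and \<open>near (\<not> s)\<close> the other one.\<close>

definition near :: "bool \<Rightarrow> 'a" where "near s = (if s then u else v)"
definition side :: "bool \<Rightarrow> 'a set" where "side s = {x \<in> V. d x (near s) < d x (near (\<not> s))}"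
definition height :: "bool \<Rightarrow> 'a \<Rightarrow> nat" where "height s x = 153 - d x (near (\<not> s))"
definition heights :: "bool \<Rightarrow> nat set" where "heights s = height s ` side s"
definition point :: "bool \<times> nat \<Rightarrow> 'a" where "point p = inv_into (side (fst p)) (height (fst p)) (snd p)"
definition mid :: "bool \<Rightarrow> 'a \<Rightarrow> 'a \<Rightarrow> 'a" where
  "mid s x y = (SOME m. m \<in> V \<and> d x (near (\<not> s)) = d x m + d m (near (\<not> s)) \<and>
     d y (near (\<not> s)) = d y m + d m (near (\<not> s)) \<and> d x y = d x m + d m y)"
definition meet :: "bool \<Rightarrow> nat \<Rightarrow> nat \<Rightarrow> nat" where
  "meet s h k = height s (mid s (point (s, h)) (point (s, k)))"

section \<open>Sides and heights along the diameter\<close>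

lemma near_in: "near s \<in> V"
  using diam by (simp add: near_def)

lemma near_dist: "d (near s) (near (\<not> s)) = 153"
  using diam sym by (simp add: near_def)

lemma dist_le: "x \<in> V \<Longrightarrow> y \<in> V \<Longrightarrow> d x y \<le> 153"
  using dist_range[of x y] self[of x] by (cases "x = y") auto

lemma mid:
  assumes "x \<in> V" "y \<in> V"
  shows "mid s x y \<in> V" "d x (near (\<not> s)) = d x (mid s x y) + d (mid s x y) (near (\<not> s))"
    "d y (near (\<not> s)) = d y (mid s x y) + d (mid s x y) (near (\<not> s))" "d x y = d x (mid s x y) + d (mid s x y) y"
  using someI_ex[OF median[OF near_in[of "\<not> s"] assms, unfolded Bex_def]] unfolding mid_def by blast+

text \<open>\<open>t\<close> is the distance from \<open>x\<close> to the path joining the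
  endpoints; the oddness of 153 then rules out ties between the sides.\<close>

lemma near_sum:
  assumes "x \<in> V"
  shows "\<exists>t. d x (near s) + d x (near (\<not> s)) = 2 * t + 153"
proof -
  let ?m = "mid s x (near s)"
  have "d x (near s) + d x (near (\<not> s)) = 2 * d x ?m + 153"
    using mid[OF assms near_in[of s], of s] near_dist[of s] sym[OF near_in[of s] mid(1)[OF assms near_in[of s], of s]] by simp
  then show ?thesis ..
qed

lemma side_in: "x \<in> side s \<Longrightarrow> x \<in> V"
  by (simp add: side_def)

text \<open>The larger of two unequal numbers with sum at least 153 is at least 77.\<close>

lemma side_far: "x \<in> side s \<Longrightarrow> 77 \<le> d x (near (\<not> s))"
  using near_sum[of x s] by (auto simp: side_def)

lemma height_add: "x \<in> side s \<Longrightarrow> height s x + d x (near (\<not> s)) = 153"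
  using dist_le[OF side_in near_in] by (simp add: height_def)

lemma side_cases: "x \<in> V \<Longrightarrow> (x \<in> side s) \<noteq> (x \<in> side (\<not> s))"
  using near_sum[of x s] by (auto simp: side_def) presburger

lemma near_side: "near s \<in> side s"
  using near_in near_dist self by (simp add: side_def)

lemma height_inj: "inj_on (height s) (side s)"
proof (rule inj_onI)
  fix x y assume xy: "x \<in> side s" "y \<in> side s" "height s x = height s y"
  then have "d x (near (\<not> s)) = d y (near (\<not> s))" using height_add by (metis add_left_cancel)
  moreover have "x \<noteq> near (\<not> s)" "y \<noteq> near (\<not> s)" using xy side_far self near_in by fastforce+
  ultimately show "x = y"
    using dist_inj[of x "near (\<not> s)" y "near (\<not> s)"] xy side_in near_in by (auto simp: doubleton_eq_iff)
qed

lemma point_height: "x \<in> side s \<Longrightarrow> point (s, height s x) = x"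
  by (simp add: point_def height_inj inv_into_f_f)

lemma point:
  assumes "h \<in> heights s"
  shows "point (s, h) \<in> side s" "height s (point (s, h)) = h" "h + d (point (s, h)) (near (\<not> s)) = 153"
  using assms point_height height_add by (auto simp: heights_def)

lemma mid_side:
  assumes "x \<in> side s" "y \<in> side s"
  shows "mid s x y \<in> side s"
proof (rule ccontr)
  let ?m = "mid s x y"
  assume "?m \<notin> side s"
  have V: "x \<in> V" "y \<in> V" "?m \<in> V" using assms side_in mid(1) by auto
  obtain t where t: "d ?m (near s) + d ?m (near (\<not> s)) = 2 * t + 153" using near_sum V by blast
  have "d ?m (near (\<not> s)) \<le> d ?m (near s)" using \<open>?m \<notin> side s\<close> V by (auto simp: side_def)
  moreover have "d x (near s) < d x (near (\<not> s))" "d y (near s) < d y (near (\<not> s))" using assms by (auto simp: side_def)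
  \<comment> \<open>As \<open>x\<close> and \<open>y\<close> are closer to the near endpoint, this
    places their median at distance more than 153/2 from the far one.\<close>
  moreover have "d x y + d (near s) (near (\<not> s)) \<le> max (d x (near (\<not> s)) + d (near s) y) (d (near (\<not> s)) y + d (near s) x)"
    using four_point near_in V by metis
  \<comment> \<open>Either the median lies on the diameter, or it lies between \<open>x\<close> and
    the near endpoint; both make it closer to the near endpoint.\<close>
  moreover have "d x (near (\<not> s)) + d (near s) ?m \<le> max (d x ?m + d (near s) (near (\<not> s))) (d ?m (near (\<not> s)) + d (near s) x)"
    using four_point near_in V by metis
  moreover note mid[OF V(1,2), of s] near_dist[of s] t sym[OF near_in V(1), of s] sym[OF near_in V(2), of s] sym[OF near_in V(3), of s]
    sym[OF near_in V(2), of "\<not> s"] sym[OF V(2,3)]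
  ultimately show False by (simp add: max_def split: if_splits)
qed

text \<open>Of the three ways to pair up the four vertices, the two with the largest sums agree. The
  side conditions make \<open>d x (near s) + d y (near (\<not> s))\<close> smaller than the sum on
  the right, which must therefore equal the third one.\<close>

lemma cross_dist:
  assumes x: "x \<in> side s" and y: "y \<in> side (\<not> s)"
  shows "d x y + 153 = d x (near (\<not> s)) + d y (near s)"
proof -
  have V: "x \<in> V" "y \<in> V" using x y side_in by auto
  have "d x y + d (near s) (near (\<not> s)) \<le> max (d x (near (\<not> s)) + d (near s) y) (d (near (\<not> s)) y + d (near s) x)"
    using four_point near_in V by metis
  moreover have "d x (near (\<not> s)) + d (near s) y \<le> max (d x y + d (near s) (near (\<not> s))) (d y (near (\<not> s)) + d (near s) x)"
    using four_point near_in V by metis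
  moreover have "d x (near s) < d x (near (\<not> s))" "d y (near (\<not> s)) < d y (near s)" using x y by (auto simp: side_def)
  moreover note near_dist[of s] sym[OF near_in V(1), of s] sym[OF near_in V(2), of s] sym[OF near_in V(2), of "\<not> s"]
  ultimately show ?thesis by (simp add: max_def split: if_splits)
qed

lemma meet_mid: "\<lbrakk>x \<in> side s; y \<in> side s\<rbrakk> \<Longrightarrow> meet s (height s x) (height s y) = height s (mid s x y)"
  by (simp add: meet_def point_height)

lemma meet:
  assumes x: "x \<in> side s" and y: "y \<in> side s"
  shows "meet s (height s x) (height s y) \<in> heights s"
    and "d x y + height s x + height s y = 2 * meet s (height s x) (height s y)"
proof -
  let ?m = "mid s x y"
  have m: "?m \<in> side s" using mid_side[OF assms] .
  then show "meet s (height s x) (height s y) \<in> heights s" by (simp add: meet_mid assms heights_def)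
  have "x \<in> V" "y \<in> V" using assms side_in by auto
  from mid[OF this, of s] sym[OF this(2) mid(1)[OF this]]
  show "d x y + height s x + height s y = 2 * meet s (height s x) (height s y)"
    using height_add[OF x] height_add[OF y] height_add[OF m] by (simp add: meet_mid assms)
qed

lemma deficit_dist:
  assumes "snd p \<in> heights (fst p)" "snd q \<in> heights (fst q)"
  shows "deficit meet p q + d (point p) (point q) = 153"
proof (cases p; cases q)
  fix s h t k assume p: "p = (s, h)" and q: "q = (t, k)"
  note P = point[of h s] and Q = point[of k t]
  show ?thesis
  proof (cases "s = t")
    case True
    then have side: "point p \<in> side s" "point q \<in> side s" using P Q p q assms by auto
    \<comment> \<open>The bound on the median by \<open>side_far\<close> makes the truncated
      subtraction in \<open>deficit\<close> exact.\<close>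
    show ?thesis
      using meet(2)[OF side] meet_mid[OF side] height_add[OF mid_side[OF side]] side_far[OF mid_side[OF side]] True P Q p q assms
      by (simp add: deficit_def)
  next
    case False
    then have "t = (\<not> s)" by auto
    then have side: "point p \<in> side s" "point q \<in> side (\<not> s)" using P Q p q assms by auto
    show ?thesis using cross_dist[OF side] P Q p q assms \<open>t = (\<not> s)\<close> by (simp add: deficit_def)
  qed
qed

lemma point_inj: "inj_on point {p. snd p \<in> heights (fst p)}"
proof (rule inj_onI)
  fix p q assume "p \<in> {p. snd p \<in> heights (fst p)}" "q \<in> {p. snd p \<in> heights (fst p)}" and eq: "point p = point q"
  then have h: "point p \<in> side (fst p)" "point q \<in> side (fst q)" "height (fst p) (point p) = snd p" "height (fst q) (point q) = snd q"
    using point[of "snd p" "fst p"] point[of "snd q" "fst q"] by auto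
  then have "fst p = fst q" using eq side_cases[of "point p" "fst p"] side_in by (cases "fst p"; cases "fst q") auto
  then show "p = q" using h eq by (simp add: prod_eq_iff)
qed

lemma ex_point:
  assumes "x \<in> V"
  shows "\<exists>p. snd p \<in> heights (fst p) \<and> point p = x"
proof -
  obtain s where "x \<in> side s" using side_cases[OF assms] by blast
  then show ?thesis by (intro exI[of _ "(s, height s x)"]) (simp add: heights_def point_height)
qed

lemma solution: "solution heights meet"
proof
  fix s x assume "x \<in> heights s"
  then show "x \<le> 76" using side_far height_add by (fastforce simp: heights_def)
next
  fix s show "0 \<in> heights s"
    using near_side[of s] near_dist[of s] by (force simp: heights_def height_def)
next
  have V: "V = side True \<union> side False" using side_cases[of _ True] side_in by auto
  moreover have "side True \<inter> side False = {}" using side_cases[of _ True] side_in by auto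
  moreover have "finite (side True)" "finite (side False)" using order V by (metis finite_Un)+
  ultimately have "card (side True) + card (side False) = 18" using order card_Un_disjoint by metis
  then show "card (heights True) + card (heights False) = 18" by (simp add: heights_def card_image height_inj)
next
  fix s h k assume "h \<in> heights s" "k \<in> heights s"
  then obtain x y where xy: "h = height s x" "x \<in> side s" "k = height s y" "y \<in> side s" by (auto simp: heights_def)
  have V: "x \<in> V" "y \<in> V" using xy side_in by auto
  let ?m = "mid s x y"
  have m: "?m \<in> side s" using mid_side xy by auto
  show "meet s h k \<in> heights s" using meet xy by simp
  show "meet s h k = meet s k h" using meet(2)[of x s y] meet(2)[of y s x] xy sym[OF V] by simp
  show "h \<le> meet s h k" using mid(2)[OF V, of s] height_add[OF m(1)] height_add[OF xy(2)] xy meet_mid by simp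
  show "meet s h (meet s h k) = meet s h k"
    using meet(2)[OF xy(2) m(1)] mid[OF V, of s] meet_mid[OF xy(2,4)] height_add[OF m(1)] height_add[OF xy(2)] xy by simp
next
  fix s h assume "h \<in> heights s"
  then obtain x where x: "h = height s x" "x \<in> side s" by (auto simp: heights_def)
  then show "meet s h h = h" using meet(2)[of x s x] self side_in by auto
next
  fix s h k l assume "h \<in> heights s" "k \<in> heights s" "l \<in> heights s"
  then obtain x y w where xy: "h = height s x" "x \<in> side s" "k = height s y" "y \<in> side s" "l = height s w" "w \<in> side s" by (auto simp: heights_def)
  have V: "x \<in> V" "y \<in> V" "w \<in> V" using xy side_in by auto
  \<comment> \<open>Based at the far endpoint, the three sums are twice the heights of the three
    medians, up to a common summand; so the four-point condition becomes the ultrametric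
    inequality.\<close>
  have "d x y + d (near (\<not> s)) w \<le> max (d x w + d (near (\<not> s)) y) (d w y + d (near (\<not> s)) x)"
    using four_point[OF near_in V] .
  then show "meet s h k \<le> max (meet s h l) (meet s l k)"
    using meet(2)[OF xy(2,4)] meet(2)[OF xy(2,6)] meet(2)[OF xy(6,4)] sym[OF near_in V(1), of "\<not> s"]
      sym[OF near_in V(2), of "\<not> s"] sym[OF near_in V(3), of "\<not> s"] height_add[OF xy(2)] height_add[OF xy(4)] height_add[OF xy(6)]
    unfolding xy(1,3,5) by linarith
next
  fix p q p' q' assume A: "snd p \<in> heights (fst p)" "snd q \<in> heights (fst q)" "p \<noteq> q"
    "snd p' \<in> heights (fst p')" "snd q' \<in> heights (fst q')" "p' \<noteq> q'" "deficit meet p q = deficit meet p' q'"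
  then have "d (point p) (point q) = d (point p') (point q')" using deficit_dist[of p q] deficit_dist[of p' q'] by simp
  moreover have "point p \<noteq> point q" "point p' \<noteq> point q'" using point_inj A by (auto dest: inj_onD)
  moreover have "point r \<in> V" if "snd r \<in> heights (fst r)" for r using point(1)[OF that] side_in by simp
  ultimately have "{point p, point q} = {point p', point q'}" using dist_inj A by presburger
  then have "point ` {p, q} = point ` {p', q'}" by simp
  then show "{p, q} = {p', q'}" using inj_on_image_eq_iff[OF point_inj] A by (metis (no_types, lifting) insert_subset empty_subsetI mem_Collect_eq)
next
  fix k :: nat assume "k < 153"
  then have "153 - k \<in> {1..153}" by auto
  from dist_surj[OF this] obtain x y where xy: "x \<in> V" "y \<in> V" "x \<noteq> y" "d x y = 153 - k" by blast
  obtain p q where "snd p \<in> heights (fst p)" "point p = x" "snd q \<in> heights (fst q)" "point q = y" using ex_point xy by metis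
  with xy deficit_dist[of p q] \<open>k < 153\<close>
  have "snd p \<in> heights (fst p) \<and> snd q \<in> heights (fst q) \<and> p \<noteq> q \<and> deficit meet p q = k" by auto
  then show "\<exists>p q. snd p \<in> heights (fst p) \<and> snd q \<in> heights (fst q) \<and> p \<noteq> q \<and> deficit meet p q = k" by blast
qed

end

section \<open>From Leech trees to the search\<close>

lemma leech_solution:
  fixes V :: "'a set"
  assumes leech: "leech_tree V E w" and card: "card V = 18"
  shows "\<exists>X z. solution X z"
proof -
  interpret weighted_tree V E w using leech by unfold_locales (simp add: leech_tree_def)
  have c: "card V choose 2 = 153" using card by (simp add: choose_two)
  have surj: "\<exists>x\<in>V. \<exists>y\<in>V. x \<noteq> y \<and> d x y = k" if "k \<in> {1..153}" for k
    using leech that unfolding leech_tree_def c by metis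
  from surj[of 153] obtain u v where uv: "u \<in> V" "v \<in> V" "d u v = 153" by auto
  interpret leech_metric V d u v
  proof
    show "finite V" "card V = 18" using leech card by (auto simp: leech_tree_def tree_graph_def fin_simple_graph_def)
    fix x y x' y' assume A: "x \<in> V" "y \<in> V" "x \<noteq> y"
    show "d x y \<in> {1..153}" using A leech unfolding leech_tree_def c by metis
    assume B: "x' \<in> V" "y' \<in> V" "x' \<noteq> y'" "d x y = d x' y'"
    have "\<exists>!P. \<exists>a\<in>V. \<exists>b\<in>V. a \<noteq> b \<and> P = {a, b} \<and> d a b = d x y"
      using A leech unfolding leech_tree_def c by metis
    then show "{x, y} = {x', y'}" using A B by metis
  qed (use dist_self dist_sym median four_point surj uv in blast)+
  show ?thesis using solution by blast
qed

theorem theorem1p1: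
  shows "\<not> (\<exists>(V :: 'a set) E w. leech_tree V E w \<and> card V = 18)"
  using leech_solution no_solution[OF refuted_init] by metis

end
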